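(* 1. Given $\Sigma_0,\Sigma_1\in\operatorname{Sym}^{++}(n)$, there exists an open interval $\Theta\supset[0,1]$ such that the curve $$\Sigma(\theta)=\left((1-\theta)I+\theta T\right)\Sigma_0\left((1-\theta)I+\theta T\right),\qquad\theta\in\Theta,$$ is the Wasserstein Riemannian geodesic through $\Sigma_0$ and $\Sigma_1$, where $T$ is the positive-definite symmetric solution of $T\Sigma_0T=\Sigma_1$. 2. Let $\Sigma_0,\dots,\Sigma_k\in\operatorname{Sym}^{++}(n)$ and, for $j=1,\dots,k$, let $T_j$ be the positive-definite symmetric solution of the Riccati equation $T_j\Sigma_0T_j=\Sigma_j$. There exists an open set $\Theta\subset\mathbb R^k$ containing the $k$-simplex such that the surface $$\Sigma(\theta)=\left(I+\sum_{j=1}^k\theta_j(T_j-I)\right)\Sigma_0\left(I+\sum_{j=1}^k\theta_j(T_j-I)\right),\qquad\theta\in\Theta,$$ is the Wasserstein Riemannian geodesic surface through $\Sigma_0,\dots,\Sigma_k$ if, and only if, the matrices $T_1,\dots,T_k$ pairwise commute.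
   Context: All matrices are real $n\times n$, $A^*$ is the transpose, $\operatorname{Sym}(n)$ the symmetric matrices, $\operatorname{Sym}^{++}(n)$ the positive-definite symmetric matrices, $\operatorname{GL}(n)$ the invertible matrices. The $k$-simplex is $\{\theta\in\mathbb R^k:\theta_j\ge0,\ \sum_j\theta_j\le1\}$. For $\Sigma\in\operatorname{Sym}^{++}(n)$ and $V\in\operatorname{Sym}(n)$, $\mathcal L_\Sigma[V]$ is the unique $X\in\operatorname{Sym}(n)$ with $X\Sigma+\Sigma X=V$. The Wasserstein Riemannian metric on $\operatorname{Sym}^{++}(n)$ is $W_\Sigma(U,V)=\operatorname{Tr}(\mathcal L_\Sigma[U]\Sigma\mathcal L_\Sigma[V])$, $U,V\in\operatorname{Sym}(n)$; with it the map $\sigma\colon\operatorname{GL}(n)\to\operatorname{Sym}^{++}(n)$, $\sigma(A)=AA^*$, is a Riemannian submersion ($\operatorname{GL}(n)$ carrying the Frobenius inner product), with horizontal space $\operatorname{Sym}(n)A$ at $A$. A smooth surface $\theta\mapsto A(\theta)\in\operatorname{GL}(n)$ is horizontal if $\left(\partial A(\theta)/\partial\theta_j\right)A(\theta)^{-1}\in\operatorname{Sym}(n)$ for all $j$ and $\theta$. A (Wasserstein Riemannian) geodesic surface through $\Sigma_0,\dots,\Sigma_k$ is a surface of the form $\Sigma(\theta)=A(\theta)A(\theta)^*$, $\theta\in\Theta$, where $A(\theta)=A_0+\sum_{j=1}^k\theta_j(A_j-A_0)\in\operatorname{GL}(n)$ is an affine surface that is horizontal for $\sigma$ on an open set $\Theta$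 containing the $k$-simplex and $A_jA_j^*=\Sigma_j$, $j=0,\dots,k$. *)

theory Defs
  imports "HOL-Analysis.Analysis"
begin

definition sym_matrices :: "(real^'n^'n) set" where
  "sym_matrices = {A. transpose A = A}"

definition pd_matrices :: "(real^'n^'n) set" where
  "pd_matrices = {A \<in> sym_matrices. \<forall>x. x \<noteq> 0 \<longrightarrow> x \<bullet> (A *v x) > 0}"

definition lyapunov :: "real^'n^'n \<Rightarrow> real^'n^'n \<Rightarrow> real^'n^'n" where
  "lyapunov P V = (THE X. X \<in> sym_matrices \<and> X ** P + P ** X = V)"

definition wasserstein_metric :: "real^'n^'n \<Rightarrow> real^'n^'n \<Rightarrow> real^'n^'n \<Rightarrow> real" where
  "wasserstein_metric P U V = trace (lyapunov P U ** P ** lyapunov P V)"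

definition wasserstein_metric_deriv ::
    "real^'n^'n \<Rightarrow> real^'n^'n \<Rightarrow> real^'n^'n \<Rightarrow> real^'n^'n \<Rightarrow> real" where
  "wasserstein_metric_deriv P H U V = deriv (\<lambda>s. wasserstein_metric (P + s *\<^sub>R H) U V) 0"

text \<open>
  The positive-definite matrices form an open subset of the vector space of symmetric
  matrices, so the Levi-Civita connection in this global chart is the flat derivative plus a
  Christoffel term. The latter is given by Koszul's formula for constant vector fields
  (whose Lie brackets vanish).
\<close>

definition wasserstein_christoffel ::
    "real^'n^'n \<Rightarrow> real^'n^'n \<Rightarrow> real^'n^'n \<Rightarrow> real^'n^'n" where
  "wasserstein_christoffel P U V = (THE C. C \<in> sym_matrices \<and>
     (\<forall>H \<in> sym_matrices. 2 * wasserstein_metric P C H =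
        wasserstein_metric_deriv P U V H + wasserstein_metric_deriv P V U H
        - wasserstein_metric_deriv P H U V))"

text \<open>
  Geodesics of the Wasserstein metric: curves whose velocity is parallel for the Levi-Civita
  connection. Twice differentiable solutions of the geodesic equation are automatically smooth.
\<close>

definition wasserstein_geodesic :: "real set \<Rightarrow> (real \<Rightarrow> real^'n^'n) \<Rightarrow> bool" where
  "wasserstein_geodesic I \<gamma> \<longleftrightarrow>
     open I \<and> is_interval I \<and> (\<forall>t\<in>I. \<gamma> t \<in> pd_matrices) \<and>
     (\<exists>v a. \<forall>t\<in>I. (\<gamma> has_vector_derivative v t) (at t) \<and>
        (v has_vector_derivative a t) (at t) \<and>
        a t + wasserstein_christoffel (\<gamma> t) (v t) (v t) = 0)"

definition geodesic_through ::
    "real set \<Rightarrow> real^'n^'n \<Rightarrow> real^'n^'n \<Rightarrow> (real \<Rightarrow> real^'n^'n) \<Rightarrow> bool" where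
  "geodesic_through I P Q \<gamma> \<longleftrightarrow>
     wasserstein_geodesic I \<gamma> \<and> {0..1} \<subseteq> I \<and> \<gamma> 0 = P \<and> \<gamma> 1 = Q"

definition the_geodesic_through ::
    "real set \<Rightarrow> real^'n^'n \<Rightarrow> real^'n^'n \<Rightarrow> (real \<Rightarrow> real^'n^'n) \<Rightarrow> bool" where
  "the_geodesic_through I P Q \<gamma> \<longleftrightarrow> geodesic_through I P Q \<gamma> \<and>
     (\<forall>J \<delta>. geodesic_through J P Q \<delta> \<longrightarrow> (\<forall>t\<in>I \<inter> J. \<delta> t = \<gamma> t))"

definition unit_simplex :: "(real^'k) set" where
  "unit_simplex = {\<theta>. (\<forall>j. 0 \<le> \<theta> $ j) \<and> (\<Sum>j\<in>UNIV. \<theta> $ j) \<le> 1}"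

text \<open>
  Smoothness is required here only as differentiability; the surfaces to which the predicate
  is applied below are affine.
\<close>

definition horizontal_surface :: "(real^'k) set \<Rightarrow> (real^'k \<Rightarrow> real^'n^'n) \<Rightarrow> bool" where
  "horizontal_surface \<Theta> A \<longleftrightarrow>
     (\<forall>\<theta>\<in>\<Theta>. invertible (A \<theta>) \<and> A differentiable (at \<theta>) \<and>
        (\<forall>j. frechet_derivative A (at \<theta>) (axis j 1) ** matrix_inv (A \<theta>) \<in> sym_matrices))"

definition affine_surface ::
    "real^'n^'n \<Rightarrow> ('k \<Rightarrow> real^'n^'n) \<Rightarrow> real^'k \<Rightarrow> real^'n^'n" where
  "affine_surface A\<^sub>0 A \<theta> = A\<^sub>0 + (\<Sum>j\<in>UNIV. \<theta> $ j *\<^sub>R (A j - A\<^sub>0))"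

text \<open>The base point is a separate argument; the other \<open>k\<close> points are indexed by the type \<open>'k\<close>.\<close>

definition geodesic_surface_through ::
    "(real^'k) set \<Rightarrow> real^'n^'n \<Rightarrow> ('k \<Rightarrow> real^'n^'n) \<Rightarrow> (real^'k \<Rightarrow> real^'n^'n) \<Rightarrow> bool" where
  "geodesic_surface_through \<Theta> S\<^sub>0 S \<Gamma> \<longleftrightarrow>
     open \<Theta> \<and> unit_simplex \<subseteq> \<Theta> \<and>
     (\<exists>A\<^sub>0 A. horizontal_surface \<Theta> (affine_surface A\<^sub>0 A) \<and>
        A\<^sub>0 ** transpose A\<^sub>0 = S\<^sub>0 \<and> (\<forall>j. A j ** transpose (A j) = S j) \<and>
        (\<forall>\<theta>\<in>\<Theta>. \<Gamma> \<theta> = affine_surface A\<^sub>0 A \<theta> ** transpose (affine_surface A\<^sub>0 A \<theta>)))"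

definition the_geodesic_surface_through ::
    "(real^'k) set \<Rightarrow> real^'n^'n \<Rightarrow> ('k \<Rightarrow> real^'n^'n) \<Rightarrow> (real^'k \<Rightarrow> real^'n^'n) \<Rightarrow> bool" where
  "the_geodesic_surface_through \<Theta> S\<^sub>0 S \<Gamma> \<longleftrightarrow> geodesic_surface_through \<Theta> S\<^sub>0 S \<Gamma> \<and>
     (\<forall>\<Theta>' \<Gamma>'. geodesic_surface_through \<Theta>' S\<^sub>0 S \<Gamma>' \<longrightarrow> (\<forall>\<theta>\<in>\<Theta> \<inter> \<Theta>'. \<Gamma>' \<theta> = \<Gamma> \<theta>))"

definition riccati :: "real^'n^'n \<Rightarrow> real^'n^'n \<Rightarrow> real^'n^'n" where
  "riccati P Q = (THE T. T \<in> pd_matrices \<and> T ** P ** T = Q)"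

end

theory Submission
  imports Defs
begin

text \<open>
  Write \<open>\<L>\<^sub>P V\<close> for the symmetric solution of the Lyapunov equation \<open>X P + P X = V\<close>. Differentiating
  that equation in \<open>P\<close> gives the derivative of \<open>\<L>\<close>, hence the derivative of the metric, and Koszul's
  formula then determines the Christoffel symbol on the diagonal: it is \<open>- 2 X P X\<close> for \<open>X = \<L>\<^sub>P V\<close>
  (\<open>wasserstein_christoffel_eq\<close>). So along a geodesic \<open>\<gamma>\<close> with \<open>X = \<L>\<^sub>\<gamma> \<gamma>'\<close> the acceleration is
  \<open>\<gamma>'' = 2 X \<gamma> X\<close>. Comparing this with the derivative of \<open>\<gamma>' = X \<gamma> + \<gamma> X\<close> leaves the Lyapunov
  equation for \<open>X' + X\<^sup>2\<close> with right-hand side zero, whence \<open>X' = - X\<^sup>2\<close>.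

  The point that makes uniqueness elementary is that these equations force
  \<open>\<gamma>''' = 2 (X' \<gamma> X + X \<gamma>' X + X \<gamma> X') = 0\<close>. A geodesic is therefore a quadratic polynomial in time, and
  matching its coefficients at \<open>0\<close> shows \<open>\<gamma> t = (1 + t H) (\<gamma> 0) (1 + t H)\<close> with \<open>H = X 0\<close>
  (\<open>wasserstein_geodesic_is_line\<close>).
  If \<open>\<gamma>\<close> joins \<open>P\<close> to \<open>Q\<close>, then \<open>1 + t H\<close> is invertible for \<open>0 \<le> t \<le> 1\<close>, which keeps every eigenvalue
  of \<open>H\<close> above \<open>-1\<close>. So \<open>1 + H\<close> is a positive definite solution of the Riccati equation, and such a
  solution is unique. The curve is thus determined by its end points. The converse, that such a
  line is a geodesic as long as \<open>1 + t H\<close> stays positive definite, is \<open>wasserstein_geodesic_line\<close>.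

  For surfaces, horizontality at \<open>\<theta> = 0\<close> says \<open>A\<^sub>j = (1 + H\<^sub>j) A\<^sub>0\<close> with \<open>H\<^sub>j\<close> symmetric, and the argument
  just given, applied to the \<open>j\<close>-th edge of the simplex, shows \<open>1 + H\<^sub>j = T\<^sub>j\<close>. This fixes the surface.
  Horizontality at the \<open>i\<close>-th vertex says that \<open>(T\<^sub>j - 1) T\<^sub>i\<^sup>-\<^sup>1\<close> is symmetric, that is, that \<open>T\<^sub>i\<close> and \<open>T\<^sub>j\<close>
  commute. Conversely, if the \<open>T\<^sub>j\<close> commute, then \<open>M \<theta> = 1 + \<Sum>\<^sub>j \<theta>\<^sub>j (T\<^sub>j - 1)\<close> commutes with every
  \<open>T\<^sub>j - 1\<close>, and \<open>\<theta> \<mapsto> (M \<theta>) P\<^sup>1\<^sup>/\<^sup>2\<close> is horizontal wherever \<open>M \<theta>\<close> is positive definite, an open set that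
  contains the simplex by convexity. The first part of the theorem uses the case of one \<open>T\<close>.
\<close>

section \<open>Symmetric matrices as self-adjoint operators\<close>

lemma bounded_bilinear_matrix_mult:
  "bounded_bilinear ((**) :: real^'n^'n \<Rightarrow> real^'n^'n \<Rightarrow> real^'n^'n)"
proof (rule bilinear_conv_bounded_bilinear[THEN iffD1], unfold bilinear_def, intro conjI allI)
  show "linear (\<lambda>B. A ** B)" for A :: "real^'n^'n"
    by (rule linearI) (simp_all add: matrix_matrix_mult_def vec_eq_iff sum_distrib_left
        algebra_simps sum.distrib)
  show "linear (\<lambda>A. A ** B)" for B :: "real^'n^'n"
    by (rule linearI) (simp_all add: matrix_matrix_mult_def vec_eq_iff sum_distrib_left
        algebra_simps sum.distrib)
qed

interpretation matrix_mult: bounded_bilinear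
  "(**) :: real^'n^'n \<Rightarrow> real^'n^'n \<Rightarrow> real^'n^'n"
  by (rule bounded_bilinear_matrix_mult)

lemmas matrix_ring_simps = matrix_mult.add_left matrix_mult.add_right matrix_mult.diff_left
  matrix_mult.diff_right matrix_mult.scaleR_left matrix_mult.scaleR_right
  matrix_mult.minus_left matrix_mult.minus_right matrix_mult.zero_left matrix_mult.zero_right
  matrix_mul_assoc scaleR_add_right scaleR_diff_right

lemma linear_transpose: "linear (transpose :: real^'n^'n \<Rightarrow> real^'n^'n)"
  by (rule linearI) (simp_all add: transpose_def vec_eq_iff)

lemma linear_trace: "linear (trace :: real^'n^'n \<Rightarrow> real)"
  by (rule linearI) (simp_all add: trace_def sum.distrib sum_distrib_left)

lemma trace_transpose: "trace (transpose A) = trace (A :: real^'n^'n)"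
  by (simp add: trace_def transpose_def)

lemma subspace_sym_matrices: "subspace (sym_matrices :: (real^'n^'n) set)"
  by (simp add: subspace_def sym_matrices_def linear_add[OF linear_transpose]
      linear_cmul[OF linear_transpose] linear_0[OF linear_transpose])

lemma mat_1_in_sym_matrices [simp]: "mat 1 \<in> sym_matrices"
  by (simp add: sym_matrices_def)

lemma sym_matrices_iff_self_adjoint:
  fixes A :: "real^'n^'n"
  shows "A \<in> sym_matrices \<longleftrightarrow> (\<forall>x y. x \<bullet> (A *v y) = (A *v x) \<bullet> y)"
proof
  assume "A \<in> sym_matrices"
  then have "A *v x = x v* A" for x
    by (metis (mono_tags) mem_Collect_eq sym_matrices_def transpose_matrix_vector)
  then show "\<forall>x y. x \<bullet> (A *v y) = (A *v x) \<bullet> y"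
    by (simp add: dot_lmul_matrix)
next
  assume *: "\<forall>x y. x \<bullet> (A *v y) = (A *v x) \<bullet> y"
  have "A *v x = transpose A *v x" for x
    using * by (metis dot_lmul_matrix transpose_matrix_vector vector_eq_rdot)
  then have "transpose A = A"
    by (metis matrix_eq)
  then show "A \<in> sym_matrices" by (simp add: sym_matrices_def)
qed

text \<open>
  A quadratic without constant term that never becomes negative has a double root at zero.
\<close>

lemma nonneg_quadratic_linear_coeff_zero:
  fixes a b :: real
  assumes "\<And>t. 0 \<le> 2 * t * a + t\<^sup>2 * b"
  shows "a = 0"
proof (rule ccontr)
  assume "a \<noteq> 0"
  define c where "c = \<bar>b\<bar> + 1"
  have c: "c > 0" "b < 2 * c" by (auto simp: c_def)
  have "2 * (- a / c) * a + (- a / c)\<^sup>2 * b = a\<^sup>2 * (b - 2 * c) / c\<^sup>2"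
    using c by (simp add: field_simps power2_eq_square)
  also have "\<dots> < 0"
    using c \<open>a \<noteq> 0\<close> by (simp add: divide_neg_pos mult_pos_neg)
  finally show False using assms[of "- a / c"] by simp
qed

text \<open>
  A minimiser of the Rayleigh quotient on an invariant subspace is an eigenvector. The extremal
  bound is part of the conclusion because it turns statements about the form into statements about
  one eigenvalue: it yields coercivity of positive definite forms and the criterion for
  \<open>1 + H\<close> to be positive definite.
\<close>

lemma minimal_eigenvector:
  fixes A :: "real^'n^'n"
  assumes A: "A \<in> sym_matrices" and S: "subspace S" "S \<noteq> {0}"
    and inv: "\<And>x. x \<in> S \<Longrightarrow> A *v x \<in> S"
  obtains x m where "x \<in> S" "norm x = 1" "A *v x = m *\<^sub>R x"
    "\<And>y. y \<in> S \<Longrightarrow> m * (y \<bullet> y) \<le> y \<bullet> (A *v y)"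
proof -
  obtain z where z: "z \<in> S" "z \<noteq> 0"
    using S subspace_0[OF S(1)] by blast
  have "compact (sphere 0 1 \<inter> S)"
    using closed_subspace[OF S(1)] by (intro compact_Int_closed compact_sphere)
  moreover have "(1 / norm z) *\<^sub>R z \<in> sphere 0 1 \<inter> S"
    using z subspace_scale[OF S(1)] by simp
  then have "sphere 0 1 \<inter> S \<noteq> {}" by blast
  moreover have "continuous_on (sphere 0 1 \<inter> S) (\<lambda>y. y \<bullet> (A *v y))"
    by (intro continuous_intros linear_continuous_on matrix_vector_mul_bounded_linear)
  ultimately obtain x where x: "x \<in> sphere 0 1 \<inter> S"
    and min: "\<And>y. y \<in> sphere 0 1 \<inter> S \<Longrightarrow> x \<bullet> (A *v x) \<le> y \<bullet> (A *v y)"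
    using continuous_attains_inf by (metis (no_types, lifting))
  define m where "m = x \<bullet> (A *v x)"
  have bound: "m * (y \<bullet> y) \<le> y \<bullet> (A *v y)" if y: "y \<in> S" for y
  proof (cases "y = 0")
    case False
    have "(1 / norm y) *\<^sub>R y \<in> sphere 0 1 \<inter> S"
      using False y subspace_scale[OF S(1)] by simp
    from min[OF this] have "m \<le> (y \<bullet> (A *v y)) / (norm y)\<^sup>2"
      by (simp add: m_def matrix_vector_mult_scaleR power2_eq_square)
    then show ?thesis
      using False by (simp add: field_simps power2_norm_eq_inner)
  qed simp
  have x': "x \<in> S" "x \<bullet> x = 1" "norm x = 1"
    using x by (auto simp: norm_eq_1)
  define y where "y = A *v x - m *\<^sub>R x"
  have yS: "y \<in> S"
    using x' inv S(1) by (simp add: y_def subspace_diff subspace_scale)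
  have sa: "x \<bullet> (A *v y) = (A *v x) \<bullet> y" for x y
    using A sym_matrices_iff_self_adjoint by blast
  \<comment> \<open>The form \<open>y \<bullet> A y - m (y \<bullet> y)\<close> is nonnegative on \<open>S\<close> and vanishes at \<open>x\<close>, so its
    first variation at \<open>x\<close> in the direction \<open>y\<close>, namely \<open>2 (y \<bullet> y)\<close>, is zero.\<close>
  have "0 \<le> 2 * t * (y \<bullet> y) + t\<^sup>2 * (y \<bullet> (A *v y) - m * (y \<bullet> y))" for t
  proof -
    have "x + t *\<^sub>R y \<in> S"
      using x' yS S(1) by (simp add: subspace_add subspace_scale)
    from bound[OF this] have "0 \<le> (x + t *\<^sub>R y) \<bullet> (A *v (x + t *\<^sub>R y)) - m * ((x + t *\<^sub>R y) \<bullet> (x + t *\<^sub>R y))"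
      by simp
    also have "\<dots> = 2 * t * (y \<bullet> (A *v x) - m * (y \<bullet> x)) + t\<^sup>2 * (y \<bullet> (A *v y) - m * (y \<bullet> y))"
      using sa[of x y] x'
      by (simp add: algebra_simps inner_add_left inner_add_right power2_eq_square
          inner_commute m_def matrix_vector_right_distrib matrix_vector_mult_scaleR)
    also have "y \<bullet> (A *v x) - m * (y \<bullet> x) = y \<bullet> y"
      by (simp add: y_def inner_diff_right inner_diff_left)
    finally show ?thesis .
  qed
  then have "y \<bullet> y = 0" by (rule nonneg_quadratic_linear_coeff_zero)
  then have "A *v x = m *\<^sub>R x" by (simp add: y_def)
  with x' bound show thesis by (intro that)
qed

text \<open>
  Spectral theorem, by splitting off one eigenvector and passing to its orthogonal complement
  in \<open>S\<close>, which is again invariant because \<open>A\<close> is self-adjoint. The basis property is stated as the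
  Fourier expansion, the form in which it is used.
\<close>

lemma orthonormal_eigenbasis_subspace:
  fixes A :: "real^'n^'n"
  assumes A: "A \<in> sym_matrices"
  shows "subspace S \<Longrightarrow> (\<And>x. x \<in> S \<Longrightarrow> A *v x \<in> S) \<Longrightarrow>
    \<exists>B. finite B \<and> B \<subseteq> S \<and> pairwise orthogonal B \<and>
      (\<forall>b\<in>B. norm b = 1 \<and> (\<exists>c. A *v b = c *\<^sub>R b)) \<and> (\<forall>y\<in>S. (\<Sum>b\<in>B. (b \<bullet> y) *\<^sub>R b) = y)"
proof (induction "dim S" arbitrary: S rule: less_induct)
  case less
  show ?case
  proof (cases "S = {0}")
    case True
    then show ?thesis by (intro exI[of _ "{}"]) auto
  next
    case False
    obtain x m where x: "x \<in> S" "norm x = 1" "A *v x = m *\<^sub>R x"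
      using minimal_eigenvector[OF A less.prems(1) False less.prems(2)] by metis
    define S' where "S' = S \<inter> {y. x \<bullet> y = 0}"
    have sub: "subspace S'"
      unfolding S'_def by (intro subspace_inter less.prems(1) subspace_hyperplane)
    have xx: "x \<bullet> x = 1" using x by (simp add: norm_eq_1)
    have "x \<notin> S'" using xx by (simp add: S'_def)
    then have "S' \<subset> S" using x(1) unfolding S'_def by blast
    then have "dim S' < dim S"
      using dim_psubset[of S' S] span_eq_iff[THEN iffD2, OF sub]
        span_eq_iff[THEN iffD2, OF less.prems(1)] by simp
    moreover have "A *v y \<in> S'" if "y \<in> S'" for y
    proof -
      have "x \<bullet> (A *v y) = (A *v x) \<bullet> y"
        using A sym_matrices_iff_self_adjoint by blast
      with that less.prems(2) show ?thesis by (simp add: S'_def x)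
    qed
    ultimately obtain B where B: "finite B" "B \<subseteq> S'" "pairwise orthogonal B"
      "\<forall>b\<in>B. norm b = 1 \<and> (\<exists>c. A *v b = c *\<^sub>R b)" "\<forall>y\<in>S'. (\<Sum>b\<in>B. (b \<bullet> y) *\<^sub>R b) = y"
      using less.hyps[OF _ sub] by blast
    have xB: "b \<bullet> x = 0" if "b \<in> B" for b
      using B(2) that by (auto simp: S'_def inner_commute)
    have "x \<notin> B" using xB xx by fastforce
    have expand: "(\<Sum>b\<in>insert x B. (b \<bullet> y) *\<^sub>R b) = y" if y: "y \<in> S" for y
    proof -
      let ?z = "y - (x \<bullet> y) *\<^sub>R x"
      have "?z \<in> S'"
        using y x less.prems(1) xx
        by (simp add: S'_def subspace_diff subspace_scale inner_diff_right)
      then have "?z = (\<Sum>b\<in>B. (b \<bullet> ?z) *\<^sub>R b)" using B(5) by simp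
      also have "\<dots> = (\<Sum>b\<in>B. (b \<bullet> y) *\<^sub>R b)"
        by (intro sum.cong) (auto simp: inner_diff_right xB)
      finally show ?thesis
        using \<open>x \<notin> B\<close> B(1) by (simp add: algebra_simps)
    qed
    show ?thesis
    proof (intro exI[of _ "insert x B"] conjI)
      show "pairwise orthogonal (insert x B)"
        using B(3) xB by (auto simp: pairwise_insert orthogonal_def inner_commute)
      show "insert x B \<subseteq> S" using x B(2) by (auto simp: S'_def)
    qed (use B x expand in auto)
  qed
qed

lemma orthonormal_eigenbasis:
  fixes A :: "real^'n^'n"
  assumes A: "A \<in> sym_matrices"
  obtains B where "finite B" "pairwise orthogonal B" "\<And>b. b \<in> B \<Longrightarrow> b \<bullet> b = 1"
    "\<And>b. b \<in> B \<Longrightarrow> A *v b = (b \<bullet> (A *v b)) *\<^sub>R b" "\<And>y. (\<Sum>b\<in>B. (b \<bullet> y) *\<^sub>R b) = y"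
proof -
  obtain B where B: "finite B" "pairwise orthogonal B"
    "\<forall>b\<in>B. norm b = 1 \<and> (\<exists>c. A *v b = c *\<^sub>R b)" "\<forall>y. (\<Sum>b\<in>B. (b \<bullet> y) *\<^sub>R b) = y"
    using orthonormal_eigenbasis_subspace[OF A subspace_UNIV] by auto
  have "b \<bullet> b = 1" if "b \<in> B" for b
    using B(3) that by (simp add: norm_eq_1)
  moreover from this have "A *v b = (b \<bullet> (A *v b)) *\<^sub>R b" if "b \<in> B" for b
    using B(3) that by fastforce
  ultimately show thesis using B by (intro that) auto
qed

section \<open>Positive definite matrices\<close>

lemma pd_sym: "A \<in> pd_matrices \<Longrightarrow> A \<in> sym_matrices"
  by (simp add: pd_matrices_def)

lemma pd_pos: "A \<in> pd_matrices \<Longrightarrow> x \<noteq> 0 \<Longrightarrow> 0 < x \<bullet> (A *v x)"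
  by (simp add: pd_matrices_def)

lemma pd_transpose: "A \<in> pd_matrices \<Longrightarrow> transpose A = A"
  by (simp add: pd_matrices_def sym_matrices_def)

lemma pd_mat_1: "mat 1 \<in> pd_matrices"
  by (simp add: pd_matrices_def)

lemma pd_invertible:
  assumes "A \<in> pd_matrices"
  shows "invertible A"
proof -
  have "x = 0" if "A *v x = 0" for x
    using pd_pos[OF assms, of x] that by fastforce
  then show ?thesis
    by (metis invertible_left_inverse matrix_left_invertible_ker)
qed

lemma convex_pd_matrices: "convex (pd_matrices :: (real^'n^'n) set)"
proof (rule convexI)
  fix A B :: "real^'n^'n" and u v :: real
  assume AB: "A \<in> pd_matrices" "B \<in> pd_matrices" and uv: "0 \<le> u" "0 \<le> v" "u + v = 1"
  have "x \<bullet> ((u *\<^sub>R A + v *\<^sub>R B) *v x) > 0" if "x \<noteq> 0" for x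
  proof -
    have "x \<bullet> ((u *\<^sub>R A + v *\<^sub>R B) *v x) = u * (x \<bullet> (A *v x)) + v * (x \<bullet> (B *v x))"
      by (simp add: matrix_vector_mult_add_rdistrib inner_add_right
          scaleR_matrix_vector_assoc[symmetric])
    moreover have "0 < u \<or> 0 < v" using uv by linarith
    ultimately show ?thesis
      using pd_pos[OF AB(1) that] pd_pos[OF AB(2) that] uv
      by (auto intro: add_pos_nonneg add_nonneg_pos)
  qed
  then show "u *\<^sub>R A + v *\<^sub>R B \<in> pd_matrices"
    using AB by (simp add: pd_matrices_def subspace_sym_matrices subspace_add subspace_scale)
qed

lemma bounded_bilinear_matrix_vector_mult:
  "bounded_bilinear ((*v) :: real^'n^'n \<Rightarrow> real^'n \<Rightarrow> real^'n)"
  by (intro bilinear_conv_bounded_bilinear[THEN iffD1])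
    (auto simp: bilinear_def matrix_vector_mult_add_rdistrib
        scaleR_matrix_vector_assoc[symmetric] intro!: linearI)

text \<open>
  The symmetric matrices have empty interior in the space of all matrices when the dimension exceeds
  one, so openness of positive definiteness is meant relative to them. It holds because the form
  of \<open>A\<close> is bounded below by its least eigenvalue times \<open>x \<bullet> x\<close>.
\<close>

lemma pd_nearby:
  fixes A :: "real^'n^'n"
  assumes A: "A \<in> pd_matrices"
  obtains e where "e > 0" "\<And>B. B \<in> sym_matrices \<Longrightarrow> dist B A < e \<Longrightarrow> B \<in> pd_matrices"
proof -
  obtain b m where b: "norm b = 1" "A *v b = m *\<^sub>R b"
    and m: "\<And>y. m * (y \<bullet> y) \<le> y \<bullet> (A *v y)"
    using minimal_eigenvector[OF pd_sym[OF A] subspace_UNIV] by (metis UNIV_I UNIV_not_singleton)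
  have "b \<noteq> 0" using b by auto
  then have "m > 0" using pd_pos[OF A, of b] b by (simp add: norm_eq_1)
  obtain K where K: "K > 0" "\<And>C (x :: real^'n). norm ((C :: real^'n^'n) *v x) \<le> norm C * norm x * K"
    using bounded_bilinear.pos_bounded[OF bounded_bilinear_matrix_vector_mult] by metis
  show thesis
  proof (rule that[of "m / K"])
    show "m / K > 0" using \<open>m > 0\<close> K by simp
  next
    fix B :: "real^'n^'n" assume B: "B \<in> sym_matrices" "dist B A < m / K"
    have "0 < x \<bullet> (B *v x)" if "x \<noteq> 0" for x
    proof -
      have "\<bar>x \<bullet> ((B - A) *v x)\<bar> \<le> norm x * norm ((B - A) *v x)"
        by (rule Cauchy_Schwarz_ineq2)
      also have "\<dots> \<le> norm x * (norm (B - A) * norm x * K)"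
        using K by (intro mult_left_mono) auto
      also have "\<dots> = (norm (B - A) * K) * (x \<bullet> x)"
        by (simp add: dot_square_norm power2_eq_square)
      also have "\<dots> < m * (x \<bullet> x)"
        using B(2) K that by (intro mult_strict_right_mono) (auto simp: dist_norm field_simps)
      finally show ?thesis
        using m[of x] by (simp add: matrix_vector_mult_diff_rdistrib inner_diff_right)
    qed
    then show "B \<in> pd_matrices" using B by (simp add: pd_matrices_def)
  qed
qed

lemma eventually_pd:
  assumes "(f \<longlongrightarrow> A) F" "A \<in> pd_matrices" "eventually (\<lambda>x. f x \<in> sym_matrices) F"
  shows "eventually (\<lambda>x. f x \<in> pd_matrices) F"
proof -
  obtain e where "e > 0" "\<And>B. B \<in> sym_matrices \<Longrightarrow> dist B A < e \<Longrightarrow> B \<in> pd_matrices"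
    using pd_nearby[OF assms(2)] by blast
  then show ?thesis
    using tendstoD[OF assms(1), of e] assms(3) by (auto elim: eventually_elim2)
qed

lemma open_pd_preimage:
  fixes f :: "'a::t2_space \<Rightarrow> real^'n^'n"
  assumes "continuous_on UNIV f" "\<And>x. f x \<in> sym_matrices"
  shows "open {x. f x \<in> pd_matrices}"
  unfolding open_subopen[of "{x. f x \<in> pd_matrices}"]
proof clarsimp
  fix x assume "f x \<in> pd_matrices"
  moreover have "(f \<longlongrightarrow> f x) (nhds x)"
    using assms(1) continuous_on_eq_continuous_at[OF open_UNIV, of f]
    by (simp add: isCont_def tendsto_at_iff_tendsto_nhds)
  ultimately have "eventually (\<lambda>y. f y \<in> pd_matrices) (nhds x)"
    using eventually_pd assms(2) by (metis (mono_tags, lifting) always_eventually)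
  then show "\<exists>T. open T \<and> x \<in> T \<and> T \<subseteq> {x. f x \<in> pd_matrices}"
    by (auto simp: eventually_nhds)
qed

lemma pd_congruence:
  fixes A M :: "real^'n^'n"
  assumes A: "A \<in> pd_matrices" and M: "invertible M"
  shows "transpose M ** A ** M \<in> pd_matrices"
proof -
  have "transpose M ** A ** M \<in> sym_matrices"
    using pd_transpose[OF A] by (simp add: sym_matrices_def matrix_transpose_mul matrix_mul_assoc)
  moreover have "0 < x \<bullet> ((transpose M ** A ** M) *v x)" if "x \<noteq> 0" for x
  proof -
    have "M *v x \<noteq> 0"
      using M that by (metis invertible_left_inverse matrix_left_invertible_ker)
    moreover have "x \<bullet> ((transpose M ** A ** M) *v x) = (M *v x) \<bullet> (A *v (M *v x))"
      by (metis dot_lmul_matrix matrix_vector_mul_assoc vector_transpose_matrix)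
    ultimately show ?thesis using pd_pos[OF A] by simp
  qed
  ultimately show ?thesis by (simp add: pd_matrices_def)
qed

text \<open>
  If the least eigenvalue \<open>m\<close> of \<open>H\<close> were at most \<open>-1\<close>, then \<open>1 + t H\<close> would be singular at
  \<open>t = - 1 / m\<close>, a point of the unit interval.
\<close>

lemma pd_of_invertible_segment:
  fixes H :: "real^'n^'n"
  assumes H: "H \<in> sym_matrices" and inv: "\<And>t. 0 \<le> t \<Longrightarrow> t \<le> 1 \<Longrightarrow> invertible (mat 1 + t *\<^sub>R H)"
  shows "mat 1 + H \<in> pd_matrices"
proof -
  obtain b m where b: "norm b = 1" "H *v b = m *\<^sub>R b"
    and m: "\<And>y. m * (y \<bullet> y) \<le> y \<bullet> (H *v y)"
    using minimal_eigenvector[OF H subspace_UNIV] by (metis UNIV_I UNIV_not_singleton)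
  have "m > -1"
  proof (rule ccontr)
    assume "\<not> m > -1"
    then have t: "0 \<le> - 1 / m" "- 1 / m \<le> 1" "m \<noteq> 0"
      by (auto simp: field_simps)
    have "(mat 1 + (- 1 / m) *\<^sub>R H) *v b = 0"
      using b t by (simp add: matrix_vector_mult_add_rdistrib matrix_vector_mult_diff_rdistrib
          scaleR_matrix_vector_assoc[symmetric])
    then have "b = 0"
      using inv[OF t(1,2)] by (metis invertible_left_inverse matrix_left_invertible_ker)
    with b show False by simp
  qed
  have "0 < x \<bullet> ((mat 1 + H) *v x)" if "x \<noteq> 0" for x
  proof -
    have "0 < (1 + m) * (x \<bullet> x)" using \<open>m > -1\<close> that by simp
    also have "\<dots> \<le> x \<bullet> ((mat 1 + H) *v x)"
      using m[of x] by (simp add: matrix_vector_mult_add_rdistrib inner_add_right algebra_simps)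
    finally show ?thesis .
  qed
  then show ?thesis
    using H by (simp add: pd_matrices_def subspace_sym_matrices subspace_add)
qed

section \<open>Sylvester equations, square roots and Riccati equations\<close>

text \<open>
  Apply the equation to an eigenvector \<open>b\<close> of \<open>N\<close> with eigenvalue \<open>c > 0\<close>: then \<open>(M + c) (X b) = 0\<close>,
  and \<open>M + c\<close> is positive definite. This single fact gives uniqueness of Lyapunov
  solutions (\<open>M = N\<close>) and uniqueness of positive definite square roots.
\<close>

lemma sylvester_injective:
  fixes M N X :: "real^'n^'n"
  assumes M: "M \<in> pd_matrices" and N: "N \<in> pd_matrices" and eq: "M ** X + X ** N = 0"
  shows "X = 0"
proof -
  obtain B where B: "\<And>b. b \<in> B \<Longrightarrow> b \<bullet> b = 1"
    "\<And>b. b \<in> B \<Longrightarrow> N *v b = (b \<bullet> (N *v b)) *\<^sub>R b" "\<And>y. (\<Sum>b\<in>B. (b \<bullet> y) *\<^sub>R b) = y"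
    by (rule orthonormal_eigenbasis[OF pd_sym[OF N]]) blast
  have "X *v b = 0" if b: "b \<in> B" for b
  proof (rule ccontr)
    assume nz: "X *v b \<noteq> 0"
    let ?c = "b \<bullet> (N *v b)"
    have "b \<noteq> 0" using B(1)[OF b] by auto
    then have c: "0 < ?c" using pd_pos[OF N] by blast
    have "0 = (M ** X + X ** N) *v b" by (simp add: eq)
    also have "\<dots> = M *v (X *v b) + X *v (N *v b)"
      by (simp add: matrix_vector_mult_add_rdistrib matrix_vector_mul_assoc)
    also have "X *v (N *v b) = ?c *\<^sub>R (X *v b)"
      by (metis B(2)[OF b] matrix_vector_mult_scaleR)
    finally have "0 = (X *v b) \<bullet> (M *v (X *v b) + ?c *\<^sub>R (X *v b))"
      by simp
    also have "\<dots> = (X *v b) \<bullet> (M *v (X *v b)) + ?c * ((X *v b) \<bullet> (X *v b))"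
      by (simp add: inner_add_right)
    also have "\<dots> > 0"
      using pd_pos[OF M nz] c nz by (simp add: add_pos_pos)
    finally show False by simp
  qed
  then have "X *v y = 0" for y
    by (subst B(3)[symmetric])
      (simp add: linear_sum[OF matrix_vector_mul_linear] matrix_vector_mult_scaleR)
  then show ?thesis by (metis matrix_eq matrix_vector_mult_0)
qed

text \<open>
  The difference solves a Sylvester equation, by \<open>A\<^sup>2 - B\<^sup>2 = A (A - B) + (A - B) B\<close>.
\<close>

lemma pd_square_root_unique:
  fixes A B :: "real^'n^'n"
  assumes "A \<in> pd_matrices" "B \<in> pd_matrices" "A ** A = B ** B"
  shows "A = B"
proof -
  have "A ** (A - B) + (A - B) ** B = 0"
    using assms(3) by (simp add: matrix_ring_simps)
  then have "A - B = 0" by (rule sylvester_injective[OF assms(1,2)])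
  then show ?thesis by simp
qed

lemma pd_square_root_exists:
  fixes A :: "real^'n^'n"
  assumes A: "A \<in> pd_matrices"
  obtains R where "R \<in> pd_matrices" "R ** R = A"
proof -
  obtain B where B: "finite B" "pairwise orthogonal B" "\<And>b. b \<in> B \<Longrightarrow> b \<bullet> b = 1"
    "\<And>b. b \<in> B \<Longrightarrow> A *v b = (b \<bullet> (A *v b)) *\<^sub>R b" "\<And>y. (\<Sum>b\<in>B. (b \<bullet> y) *\<^sub>R b) = y"
    by (rule orthonormal_eigenbasis[OF pd_sym[OF A]]) blast
  define l where "l b = b \<bullet> (A *v b)" for b
  have l: "0 < l b" if "b \<in> B" for b
    using pd_pos[OF A, of b] B(3)[OF that] by (cases "b = 0") (auto simp: l_def)
  define f where "f x = (\<Sum>b\<in>B. (sqrt (l b) * (b \<bullet> x)) *\<^sub>R b)" for x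
  have lin: "linear f"
    by (rule linearI) (simp_all add: f_def inner_add_right distrib_left scaleR_add_left
        sum.distrib scaleR_sum_right mult.left_commute)
  have inner_f: "x \<bullet> f y = (\<Sum>b\<in>B. sqrt (l b) * (b \<bullet> x) * (b \<bullet> y))" for x y
    unfolding f_def inner_sum_right
    by (intro sum.cong) (simp_all add: inner_commute[of x] mult.assoc mult.left_commute)
  have f_eigen: "f b = sqrt (l b) *\<^sub>R b" if b: "b \<in> B" for b
  proof -
    have "f b = (\<Sum>c\<in>B. if c = b then sqrt (l b) *\<^sub>R b else 0)"
      unfolding f_def using B(2,3) b
      by (intro sum.cong) (auto simp: pairwise_def orthogonal_def)
    then show ?thesis using B(1) b by simp
  qed
  have f_f: "f (f y) = A *v y" for y
  proof -
    have "f (f y) = (\<Sum>b\<in>B. (sqrt (l b) * (b \<bullet> y)) *\<^sub>R f b)"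
      by (subst (2) f_def) (simp add: linear_sum[OF lin] linear_cmul[OF lin])
    also have "\<dots> = (\<Sum>b\<in>B. (b \<bullet> y) *\<^sub>R (A *v b))"
    proof (intro sum.cong refl)
      fix b assume b: "b \<in> B"
      have "sqrt (l b) * sqrt (l b) = l b"
        using l[OF b] by simp
      then have "(sqrt (l b) * (b \<bullet> y)) *\<^sub>R f b = ((b \<bullet> y) * l b) *\<^sub>R b"
        by (simp add: f_eigen[OF b] mult.commute mult.left_commute)
      then show "(sqrt (l b) * (b \<bullet> y)) *\<^sub>R f b = (b \<bullet> y) *\<^sub>R (A *v b)"
        by (subst B(4)[OF b]) (simp add: l_def)
    qed
    also have "\<dots> = A *v (\<Sum>b\<in>B. (b \<bullet> y) *\<^sub>R b)"
      by (simp add: linear_sum[OF matrix_vector_mul_linear] matrix_vector_mult_scaleR)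
    finally show ?thesis by (simp add: B(5))
  qed
  have mf: "matrix f *v x = f x" for x
    by (simp add: lin)
  show thesis
  proof (rule that[of "matrix f"])
    show "matrix f ** matrix f = A"
      unfolding matrix_eq matrix_vector_mul_assoc[symmetric] mf f_f by simp
    have "matrix f \<in> sym_matrices"
      unfolding sym_matrices_iff_self_adjoint mf
    proof (intro allI)
      fix x y
      have "x \<bullet> f y = y \<bullet> f x" by (simp add: inner_f mult.assoc mult.commute[of "_ \<bullet> x"])
      then show "x \<bullet> f y = f x \<bullet> y" by (simp add: inner_commute)
    qed
    moreover have "0 < x \<bullet> f x" if "x \<noteq> 0" for x
    proof -
      have "\<exists>b\<in>B. b \<bullet> x \<noteq> 0"
        using B(5)[of x] that by (metis (no_types, lifting) scale_eq_0_iff sum.neutral)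
      then obtain b where b: "b \<in> B" "b \<bullet> x \<noteq> 0" by blast
      have "0 \<le> sqrt (l c) * (c \<bullet> x) * (c \<bullet> x)" if "c \<in> B" for c
        using l[OF that] by (simp add: mult.assoc)
      moreover have "0 < sqrt (l b) * (b \<bullet> x) * (b \<bullet> x)"
        using b l[OF b(1)] by (auto simp: mult.assoc zero_less_mult_iff)
      ultimately show ?thesis
        unfolding inner_f using B(1) b(1) by (intro sum_pos2) auto
    qed
    ultimately show "matrix f \<in> pd_matrices"
      by (simp add: pd_matrices_def mf)
  qed
qed

lemma matrix_inv_cancel:
  fixes M :: "real^'n^'n"
  assumes "invertible M"
  shows "M ** matrix_inv M = mat 1" "matrix_inv M ** M = mat 1"
    "X ** M ** matrix_inv M = X" "X ** matrix_inv M ** M = X"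
proof -
  have *: "M ** matrix_inv M = mat 1 \<and> matrix_inv M ** M = mat 1"
    using assms unfolding invertible_def matrix_inv_def by (rule someI_ex)
  then show "M ** matrix_inv M = mat 1" "matrix_inv M ** M = mat 1" by auto
  from * show "X ** M ** matrix_inv M = X" "X ** matrix_inv M ** M = X"
    by (metis matrix_mul_assoc matrix_mul_rid)+
qed

lemma matrix_inv_eqI:
  fixes M N :: "real^'n^'n"
  assumes "M ** N = mat 1"
  shows "matrix_inv M = N"
proof -
  have "invertible M" using assms invertible_right_inverse by blast
  then show ?thesis
    by (metis assms matrix_inv_cancel(2) matrix_mul_assoc matrix_mul_lid matrix_mul_rid)
qed

lemma matrix_inv_mult:
  fixes M N :: "real^'n^'n"
  assumes "invertible M" "invertible N"
  shows "matrix_inv (M ** N) = matrix_inv N ** matrix_inv M"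
  by (rule matrix_inv_eqI) (simp add: matrix_mul_assoc matrix_inv_cancel assms)

lemma transpose_matrix_inv:
  fixes M :: "real^'n^'n"
  assumes "invertible M"
  shows "transpose (matrix_inv M) = matrix_inv (transpose M)"
  by (rule matrix_inv_eqI[symmetric])
    (simp add: matrix_transpose_mul[symmetric] matrix_inv_cancel assms)

lemma sym_matrix_inv:
  assumes "M \<in> sym_matrices" "invertible M"
  shows "matrix_inv M \<in> sym_matrices"
  using assms by (simp add: sym_matrices_def transpose_matrix_inv)

lemma invertible_matrix_inv: "invertible M \<Longrightarrow> invertible (matrix_inv (M :: real^'n^'n))"
  using matrix_inv_cancel(1,2)[of M] unfolding invertible_def by blast

text \<open>
  With \<open>R\<^sup>2 = P\<close>, the Riccati equation for \<open>T\<close> says that \<open>R T R\<close> is a square root of \<open>R Q R\<close>; both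
  existence and uniqueness are thereby reduced to square roots.
\<close>

lemma riccati_solution_unique:
  fixes P T S :: "real^'n^'n"
  assumes P: "P \<in> pd_matrices" and T: "T \<in> pd_matrices" and S: "S \<in> pd_matrices"
    and eq: "T ** P ** T = S ** P ** S"
  shows "T = S"
proof -
  obtain R where R: "R \<in> pd_matrices" "R ** R = P"
    by (rule pd_square_root_exists[OF P])
  have inv: "invertible R" by (rule pd_invertible[OF R(1)])
  have square: "(R ** M ** R) ** (R ** M ** R) = R ** (M ** P ** M) ** R" for M
    by (simp add: matrix_mul_assoc R(2)[symmetric])
  have pd: "R ** M ** R \<in> pd_matrices" if "M \<in> pd_matrices" for M
    using pd_congruence[OF that inv] pd_transpose[OF R(1)] by simp
  have "(R ** T ** R) ** (R ** T ** R) = (R ** S ** R) ** (R ** S ** R)"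
    using square[of T] square[of S] eq by simp
  then have RTR: "R ** T ** R = R ** S ** R"
    by (rule pd_square_root_unique[OF pd[OF T] pd[OF S]])
  have "T = matrix_inv R ** (R ** T ** R) ** matrix_inv R"
    by (simp add: matrix_mul_assoc matrix_inv_cancel[OF inv])
  also have "\<dots> = S"
    unfolding RTR by (simp add: matrix_mul_assoc matrix_inv_cancel[OF inv])
  finally show ?thesis .
qed

lemma riccati_solution_exists:
  fixes P Q :: "real^'n^'n"
  assumes P: "P \<in> pd_matrices" and Q: "Q \<in> pd_matrices"
  shows "\<exists>T\<in>pd_matrices. T ** P ** T = Q"
proof -
  obtain R where R: "R \<in> pd_matrices" "R ** R = P"
    by (rule pd_square_root_exists[OF P])
  have inv: "invertible R" by (rule pd_invertible[OF R(1)])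
  have RQR: "R ** Q ** R \<in> pd_matrices"
    using pd_congruence[OF Q inv] pd_transpose[OF R(1)] by simp
  obtain K where K: "K \<in> pd_matrices" "K ** K = R ** Q ** R"
    by (rule pd_square_root_exists[OF RQR])
  let ?I = "matrix_inv R"
  have "transpose ?I = ?I"
    using sym_matrix_inv[OF pd_sym[OF R(1)] inv] by (simp add: sym_matrices_def)
  then have "?I ** K ** ?I \<in> pd_matrices"
    using pd_congruence[OF K(1) invertible_matrix_inv[OF inv]] by simp
  moreover have "(?I ** K ** ?I) ** P ** (?I ** K ** ?I) = Q"
  proof -
    have "(?I ** K ** ?I) ** P ** (?I ** K ** ?I) = ?I ** (K ** K) ** ?I"
      by (simp add: R(2)[symmetric] matrix_mul_assoc matrix_inv_cancel[OF inv])
    also have "\<dots> = Q"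
      by (simp add: K(2) matrix_mul_assoc matrix_inv_cancel[OF inv])
    finally show ?thesis .
  qed
  ultimately show ?thesis by blast
qed

lemma riccati_eqI:
  assumes "P \<in> pd_matrices" "T \<in> pd_matrices" "T ** P ** T = Q"
  shows "riccati P Q = T"
  unfolding riccati_def
proof (rule the_equality)
  show "T \<in> pd_matrices \<and> T ** P ** T = Q" using assms by simp
next
  fix S assume "S \<in> pd_matrices \<and> S ** P ** S = Q"
  then show "S = T"
    by (metis assms riccati_solution_unique)
qed

lemma riccati:
  fixes P Q :: "real^'n^'n"
  assumes "P \<in> pd_matrices" "Q \<in> pd_matrices"
  shows "riccati P Q \<in> pd_matrices" "riccati P Q ** P ** riccati P Q = Q"
proof -
  obtain T where T: "T \<in> pd_matrices" "T ** P ** T = Q"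
    using riccati_solution_exists[OF assms] by blast
  then have "riccati P Q = T" by (rule riccati_eqI[OF assms(1)])
  with T show "riccati P Q \<in> pd_matrices" "riccati P Q ** P ** riccati P Q = Q"
    by simp_all
qed

section \<open>The Lyapunov operator and its dependence on the base point\<close>

lemma lyapunov_injective:
  fixes P X Y :: "real^'n^'n"
  assumes "P \<in> pd_matrices" "X ** P + P ** X = Y ** P + P ** Y"
  shows "X = Y"
proof -
  have "P ** (X - Y) + (X - Y) ** P = 0"
    using assms(2) by (simp add: matrix_ring_simps algebra_simps)
  then have "X - Y = 0"
    by (rule sylvester_injective[OF assms(1,1)])
  then show ?thesis by simp
qed

lemma linear_lyapunov_operator: "linear (\<lambda>X. X ** P + P ** (X :: real^'n^'n))"
  by (rule linearI) (simp_all add: matrix_ring_simps)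

lemma transpose_lyapunov:
  fixes P :: "real^'n^'n"
  assumes "P \<in> sym_matrices"
  shows "transpose (X ** P + P ** X) = transpose X ** P + P ** transpose X"
  using assms
  by (simp add: linear_add[OF linear_transpose] matrix_transpose_mul sym_matrices_def add.commute)

text \<open>
  The transpose of a solution is a solution too, so symmetry is a consequence of uniqueness.
\<close>

lemma lyapunov_solution_sym:
  fixes P :: "real^'n^'n"
  assumes P: "P \<in> pd_matrices" and "X ** P + P ** X \<in> sym_matrices"
  shows "X \<in> sym_matrices"
proof -
  have "transpose X ** P + P ** transpose X = X ** P + P ** X"
    using assms(2) transpose_lyapunov[OF pd_sym[OF P], of X] by (simp add: sym_matrices_def)
  then have "transpose X = X" by (rule lyapunov_injective[OF P])
  then show ?thesis by (simp add: sym_matrices_def)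
qed

lemma lyapunov_eqI:
  assumes P: "P \<in> pd_matrices" and X: "X \<in> sym_matrices" and eq: "X ** P + P ** X = V"
  shows "lyapunov P V = X"
  unfolding lyapunov_def
proof (rule the_equality)
  show "X \<in> sym_matrices \<and> X ** P + P ** X = V" using X eq by simp
next
  fix Y assume "Y \<in> sym_matrices \<and> Y ** P + P ** Y = V"
  then have "Y ** P + P ** Y = X ** P + P ** X" using eq by simp
  then show "Y = X" by (rule lyapunov_injective[OF P])
qed

lemma
  fixes P V :: "real^'n^'n"
  assumes P: "P \<in> pd_matrices" and V: "V \<in> sym_matrices"
  shows lyapunov_sym: "lyapunov P V \<in> sym_matrices"
    and lyapunov_eq: "lyapunov P V ** P + P ** lyapunov P V = V"
proof -
  have "inj (\<lambda>X. X ** P + P ** X)"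
    by (rule injI) (rule lyapunov_injective[OF P])
  then have "surj (\<lambda>X. X ** P + P ** X)"
    by (rule linear_inj_imp_surj[OF linear_lyapunov_operator])
  then have "V \<in> range (\<lambda>X. X ** P + P ** X)" by simp
  then obtain X where X: "X ** P + P ** X = V" by (elim rangeE) simp
  have "X \<in> sym_matrices" by (rule lyapunov_solution_sym[OF P]) (simp add: X V)
  moreover from this X have "lyapunov P V = X" by (rule lyapunov_eqI[OF P])
  ultimately show "lyapunov P V \<in> sym_matrices" "lyapunov P V ** P + P ** lyapunov P V = V"
    using X by simp_all
qed

lemma sym_lyapunov_image:
  fixes P :: "real^'n^'n"
  assumes "P \<in> sym_matrices" "X \<in> sym_matrices"
  shows "X ** P + P ** X \<in> sym_matrices"
  using transpose_lyapunov[OF assms(1), of X] assms(2) by (simp add: sym_matrices_def)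

text \<open>
  This is implicit differentiation of \<open>X S + S X = V\<close>. Differentiability of \<open>X\<close> is part of the claim: the
  Lyapunov operator at \<open>S t\<close> is bounded below, and this persists for nearby \<open>S s\<close>, so the remainder of
  the first-order expansion of \<open>X\<close> is controlled by that of the right-hand side.
\<close>

lemma has_vector_derivative_lyapunov_solution:
  fixes S V X :: "real \<Rightarrow> real^'n^'n"
  assumes S: "(S has_vector_derivative S') (at t)" and V: "(V has_vector_derivative V') (at t)"
    and P: "S t \<in> pd_matrices"
    and eq: "eventually (\<lambda>s. X s ** S s + S s ** X s = V s) (nhds t)"
    and Y: "Y ** S t + S t ** Y = V' - (X t ** S' + S' ** X t)"
  shows "(X has_vector_derivative Y) (at t)"
proof -
  let ?P = "S t"
  define E where "E s = X s - X t - (s - t) *\<^sub>R Y" for s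
  define R where "R s = V s - (X t ** S s + S s ** X t)
    - ((s - t) *\<^sub>R (Y ** S s) + (s - t) *\<^sub>R (S s ** Y))" for s
  have eq_t: "X t ** ?P + ?P ** X t = V t"
    by (rule eventually_nhds_x_imp_x[OF eq])
  have R_t: "R t = 0" by (simp add: R_def eq_t)
  have "((\<lambda>s. s - t) has_real_derivative 1) (at t)"
    by (auto intro!: derivative_eq_intros)
  then have "(R has_vector_derivative (V' - (X t ** S' + S' ** X t)
      - (((t - t) *\<^sub>R (Y ** S') + 1 *\<^sub>R (Y ** S t)) + ((t - t) *\<^sub>R (S' ** Y) + 1 *\<^sub>R (S t ** Y))))) (at t)"
    unfolding R_def
    by (intro has_vector_derivative_diff has_vector_derivative_add has_vector_derivative_scaleR
        V bounded_linear.has_vector_derivative[OF matrix_mult.bounded_linear_right]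
        bounded_linear.has_vector_derivative[OF matrix_mult.bounded_linear_left] S)
  then have "(R has_vector_derivative 0) (at t)"
    using Y by simp
  then have quotient: "((\<lambda>s. R s /\<^sub>R norm (s - t)) \<longlongrightarrow> 0) (at t)"
    by (simp add: has_vector_derivative_def has_derivative_at_within R_t)
  have R_small: "((\<lambda>s. norm (R s) / norm (s - t)) \<longlongrightarrow> 0) (at t)"
    using tendsto_norm_zero[OF quotient] by (simp add: divide_inverse mult.commute)
  \<comment> \<open>\<open>E s\<close> solves the Lyapunov equation at \<open>S s\<close> with right-hand side \<open>R s = o(s - t)\<close>.\<close>
  obtain b where b: "b > 0" "\<And>X. b * norm X \<le> norm (X ** ?P + ?P ** X)"
  proof -
    have inj: "inj (\<lambda>X. X ** ?P + ?P ** X)"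
      by (rule injI) (rule lyapunov_injective[OF P])
    show ?thesis
      by (rule linear_inj_bounded_below_pos[OF linear_lyapunov_operator inj]) (rule that)
  qed
  obtain K where K: "K > 0"
    "\<And>A B. norm ((A :: real^'n^'n) ** (B :: real^'n^'n)) \<le> norm A * norm B * K"
    using matrix_mult.pos_bounded by blast
  have "(S \<longlongrightarrow> ?P) (at t)"
    using has_vector_derivative_continuous[OF S] by (simp add: continuous_within)
  \<comment> \<open>This radius costs at most half of the lower bound \<open>b\<close>: the perturbation contributes two
    products, each bounded by \<open>K\<close> times the product of the norms.\<close>
  then have near: "eventually (\<lambda>s. dist (S s) ?P < b / (4 * K)) (at t)"
    using b(1) K(1) by (intro tendstoD) auto
  have "eventually (\<lambda>s. norm (E s) \<le> norm (R s) * (2 / b)) (at t)"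
    using near eventually_nhds_conv_at[THEN iffD1, OF eq, THEN conjunct1]
  proof eventually_elim
    case (elim s)
    let ?D = "S s - ?P"
    have "E s ** S s + S s ** E s = R s"
      using elim(2)[symmetric] by (simp add: E_def R_def matrix_ring_simps algebra_simps)
    then have "E s ** ?P + ?P ** E s = R s - (E s ** ?D + ?D ** E s)"
      by (simp add: matrix_ring_simps algebra_simps)
    then have "norm (E s ** ?P + ?P ** E s) \<le> norm (R s) + (norm (E s ** ?D) + norm (?D ** E s))"
      using norm_triangle_ineq4[of "R s" "E s ** ?D + ?D ** E s"]
        norm_triangle_ineq[of "E s ** ?D" "?D ** E s"] by simp
    moreover have "norm (E s ** ?D) + norm (?D ** E s) \<le> norm (E s) * norm ?D * K + norm ?D * norm (E s) * K"
      by (intro add_mono K(2))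
    moreover have "norm (E s) * (norm ?D * K) \<le> norm (E s) * (b / 4)"
      using elim(1) K(1) by (intro mult_left_mono) (auto simp: dist_norm field_simps)
    ultimately have "b * norm (E s) \<le> norm (R s) + norm (E s) * (b / 2)"
      using b(2)[of "E s"] by (simp add: algebra_simps)
    then show "norm (E s) \<le> norm (R s) * (2 / b)"
      using b(1) by (simp add: field_simps)
  qed
  then have "eventually (\<lambda>s. norm (norm (E s) / norm (s - t)) \<le> norm (norm (R s) / norm (s - t)) * (2 / b)) (at t)"
  proof eventually_elim
    case (elim s)
    then have "norm (E s) / norm (s - t) \<le> norm (R s) * (2 / b) / norm (s - t)"
      by (intro divide_right_mono) auto
    then show ?case by (simp add: mult.commute)
  qed
  then have "((\<lambda>s. norm (E s) / norm (s - t)) \<longlongrightarrow> 0) (at t)"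
    by (rule tendsto_0_le[OF R_small])
  then show ?thesis
    by (simp add: has_vector_derivative_def has_derivative_iff_norm E_def bounded_linear_scaleR_left)
qed

section \<open>The Christoffel symbol of the Wasserstein metric\<close>

lemma trace_cyclic:
  fixes A B C :: "real^'n^'n"
  shows "trace (A ** B ** C) = trace (C ** A ** B)"
  using trace_mul_sym[of "A ** B" C] by (simp add: matrix_mul_assoc)

lemma trace_reverse:
  fixes A B C :: "real^'n^'n"
  assumes "A \<in> sym_matrices" "B \<in> sym_matrices" "C \<in> sym_matrices"
  shows "trace (A ** B ** C) = trace (C ** B ** A)"
  using trace_transpose[of "A ** B ** C"] assms
  by (simp add: matrix_transpose_mul matrix_mul_assoc sym_matrices_def)

lemma wasserstein_metric_commute:
  assumes P: "P \<in> pd_matrices" and U: "U \<in> sym_matrices" and V: "V \<in> sym_matrices"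
  shows "wasserstein_metric P U V = wasserstein_metric P V U"
  unfolding wasserstein_metric_def
  by (intro trace_reverse pd_sym lyapunov_sym assms)

text \<open>
  One of the two Lyapunov solutions in the metric can be traded for its right-hand side, which
  makes the metric depend on the base point through a single solution.
\<close>

lemma wasserstein_metric_eq_trace:
  assumes P: "P \<in> pd_matrices" and U: "U \<in> sym_matrices" and V: "V \<in> sym_matrices"
  shows "wasserstein_metric P U V = trace (lyapunov P U ** V) / 2"
proof -
  let ?X = "lyapunov P U" and ?Z = "lyapunov P V"
  have X: "?X \<in> sym_matrices" and Z: "?Z \<in> sym_matrices"
    using lyapunov_sym[OF P] U V by auto
  have "trace (?X ** V) = trace (?X ** (?Z ** P + P ** ?Z))"
    by (simp only: lyapunov_eq[OF P V])
  also have "\<dots> = trace (?X ** ?Z ** P) + trace (?X ** P ** ?Z)"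
    by (simp add: matrix_ring_simps trace_add)
  also have "trace (?X ** ?Z ** P) = trace (P ** ?X ** ?Z)"
    by (rule trace_cyclic)
  also have "\<dots> = trace (?Z ** ?X ** P)"
    by (rule trace_reverse[OF pd_sym[OF P] X Z])
  also have "\<dots> = trace (P ** ?Z ** ?X)"
    by (rule trace_cyclic)
  also have "\<dots> = trace (?X ** P ** ?Z)"
    by (rule trace_cyclic)
  finally show ?thesis by (simp add: wasserstein_metric_def)
qed

text \<open>
  Differentiating \<open>X (P + s H) + (P + s H) X = U\<close> in \<open>s\<close> shows that \<open>X' = \<L>\<^sub>P (- (X H + H X))\<close>. The derivative of
  the metric is thus a value of the metric itself, and its symmetry moves \<open>\<L>\<^sub>P\<close> over to \<open>V\<close>.
\<close>

lemma wasserstein_metric_deriv_eq: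
  assumes P: "P \<in> pd_matrices" and H: "H \<in> sym_matrices"
    and U: "U \<in> sym_matrices" and V: "V \<in> sym_matrices"
  shows "wasserstein_metric_deriv P H U V = - trace (lyapunov P U ** H ** lyapunov P V)"
proof -
  let ?S = "\<lambda>s. P + s *\<^sub>R H"
  let ?X = "lyapunov P U" and ?Z = "lyapunov P V"
  have X: "?X \<in> sym_matrices" and Z: "?Z \<in> sym_matrices"
    using lyapunov_sym[OF P] U V by auto
  define W where "W = ?X ** H + H ** ?X"
  have W: "- W \<in> sym_matrices"
    unfolding W_def by (intro subspace_neg[OF subspace_sym_matrices] sym_lyapunov_image H X)
  define Y where "Y = lyapunov P (- W)"
  have "(?S \<longlongrightarrow> P + 0 *\<^sub>R H) (nhds 0)"
    by (intro tendsto_intros filterlim_ident)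
  then have near: "eventually (\<lambda>s. ?S s \<in> pd_matrices) (nhds 0)"
    using P by (intro eventually_pd[of ?S P])
      (auto intro!: always_eventually subspace_add[OF subspace_sym_matrices]
        subspace_scale[OF subspace_sym_matrices] pd_sym[OF P] H)
  have "((\<lambda>s. lyapunov (?S s) U) has_vector_derivative Y) (at 0)"
  proof (rule has_vector_derivative_lyapunov_solution)
    show "(?S has_vector_derivative H) (at 0)"
      by (auto intro!: derivative_eq_intros)
    show "((\<lambda>s. U) has_vector_derivative 0) (at 0)" by simp
    show "?S 0 \<in> pd_matrices" using P by simp
    show "\<forall>\<^sub>F s in nhds 0. lyapunov (?S s) U ** ?S s + ?S s ** lyapunov (?S s) U = U"
      using near by eventually_elim (rule lyapunov_eq[OF _ U])
    show "Y ** ?S 0 + ?S 0 ** Y = 0 - (lyapunov (?S 0) U ** H + H ** lyapunov (?S 0) U)"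
      using lyapunov_eq[OF P W] by (simp add: Y_def W_def)
  qed
  moreover have "bounded_linear (\<lambda>A. trace (A ** V) / 2)"
    unfolding linear_conv_bounded_linear[symmetric]
    by (rule linearI) (simp_all add: matrix_ring_simps linear_add[OF linear_trace]
        linear_cmul[OF linear_trace] add_divide_distrib)
  ultimately have "((\<lambda>s. trace (lyapunov (?S s) U ** V) / 2) has_vector_derivative trace (Y ** V) / 2) (at 0)"
    using bounded_linear.has_vector_derivative by blast
  then have d: "((\<lambda>s. trace (lyapunov (?S s) U ** V) / 2) has_real_derivative trace (Y ** V) / 2) (at 0)"
    by (simp add: has_real_derivative_iff_has_vector_derivative)
  have "eventually (\<lambda>s. wasserstein_metric (?S s) U V = trace (lyapunov (?S s) U ** V) / 2) (nhds 0)"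
    using near by eventually_elim (rule wasserstein_metric_eq_trace[OF _ U V])
  from DERIV_cong_ev[OF refl this refl] d
  have "((\<lambda>s. wasserstein_metric (?S s) U V) has_real_derivative trace (Y ** V) / 2) (at 0)"
    by blast
  then have "wasserstein_metric_deriv P H U V = trace (Y ** V) / 2"
    unfolding wasserstein_metric_deriv_def by (rule DERIV_imp_deriv)
  also have "\<dots> = wasserstein_metric P (- W) V"
    unfolding Y_def by (rule wasserstein_metric_eq_trace[OF P W V, symmetric])
  also have "\<dots> = trace (?Z ** - W) / 2"
    using wasserstein_metric_commute[OF P W V] wasserstein_metric_eq_trace[OF P V W] by simp
  also have "\<dots> = - (trace (?Z ** ?X ** H) + trace (?Z ** H ** ?X)) / 2"
    by (simp add: W_def matrix_ring_simps trace_sub linear_neg[OF linear_trace])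
  also have "trace (?Z ** ?X ** H) = trace (?X ** H ** ?Z)"
    by (rule trace_cyclic[symmetric])
  also have "trace (?Z ** H ** ?X) = trace (?X ** H ** ?Z)"
    by (rule trace_reverse[OF Z H X])
  finally show ?thesis by simp
qed

lemma trace_square_sym_eq_0:
  fixes D :: "real^'n^'n"
  assumes D: "D \<in> sym_matrices" and "trace (D ** D) = 0"
  shows "D = 0"
proof -
  have sym: "D $ i $ j = D $ j $ i" for i j
    using D by (metis (mono_tags) mem_Collect_eq sym_matrices_def transpose_def vec_lambda_beta)
  have "trace (D ** D) = (\<Sum>i\<in>UNIV. \<Sum>j\<in>UNIV. D $ i $ j * D $ j $ i)"
    by (simp add: trace_def matrix_matrix_mult_def)
  also have "\<dots> = D \<bullet> D"
    unfolding inner_vec_def by (simp add: sym)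
  finally show ?thesis using assms by simp
qed

text \<open>
  With \<open>Z = \<L>\<^sub>P H\<close>, Koszul's equation becomes \<open>tr (Z C) = - 2 tr (X V Z) + tr (X H X)\<close>. Substituting
  \<open>V = X P + P X\<close> and \<open>H = Z P + P Z\<close> cancels everything on the right except \<open>- 2 tr (X P X Z)\<close>. The symbol is
  determined by this because \<open>\<L>\<^sub>P\<close> is onto the symmetric matrices, so \<open>Z\<close> may be chosen to be the
  difference of two solutions.
\<close>

lemma wasserstein_christoffel_eq:
  fixes P X :: "real^'n^'n"
  assumes P: "P \<in> pd_matrices" and X: "X \<in> sym_matrices" and V: "V = X ** P + P ** X"
  shows "wasserstein_christoffel P V V = - (2 *\<^sub>R (X ** P ** X))"
proof -
  have Vs: "V \<in> sym_matrices"
    unfolding V by (intro sym_lyapunov_image pd_sym P X)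
  have LV: "lyapunov P V = X"
    using P X V by (intro lyapunov_eqI) auto
  let ?C = "- (2 *\<^sub>R (X ** P ** X))"
  have "X ** P ** X \<in> sym_matrices"
    using X pd_sym[OF P] by (simp add: sym_matrices_def matrix_transpose_mul matrix_mul_assoc)
  then have C: "?C \<in> sym_matrices"
    by (intro subspace_neg subspace_scale subspace_sym_matrices)
  have left: "2 * wasserstein_metric P D H = trace (lyapunov P H ** D)"
    if "D \<in> sym_matrices" "H \<in> sym_matrices" for D H
    using wasserstein_metric_commute[OF P that] wasserstein_metric_eq_trace[OF P that(2,1)] by simp
  have right: "wasserstein_metric_deriv P V V H + wasserstein_metric_deriv P V V H
      - wasserstein_metric_deriv P H V V = trace (lyapunov P H ** ?C)"
    if H: "H \<in> sym_matrices" for H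
  proof -
    let ?Z = "lyapunov P H"
    have Z: "?Z \<in> sym_matrices" by (rule lyapunov_sym[OF P H])
    have "trace (X ** V ** ?Z) = trace (X ** X ** P ** ?Z) + trace (X ** P ** X ** ?Z)"
      by (simp add: V matrix_ring_simps trace_add)
    moreover have "trace (X ** H ** X) = 2 * trace (X ** X ** P ** ?Z)"
    proof -
      have "trace (X ** H ** X) = trace (X ** (?Z ** P + P ** ?Z) ** X)"
        by (simp only: lyapunov_eq[OF P H])
      also have "\<dots> = trace (X ** (?Z ** P) ** X) + trace (X ** (P ** ?Z) ** X)"
        by (simp add: matrix_ring_simps trace_add)
      also have "trace (X ** (P ** ?Z) ** X) = trace (X ** X ** (P ** ?Z))"
        by (rule trace_cyclic)
      also have "trace (X ** (?Z ** P) ** X) = trace (transpose (X ** (?Z ** P) ** X))"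
        by (rule trace_transpose[symmetric])
      also have "transpose (X ** (?Z ** P) ** X) = X ** (P ** ?Z) ** X"
        using X Z pd_sym[OF P] by (simp add: sym_matrices_def matrix_transpose_mul matrix_mul_assoc)
      also have "trace (X ** (P ** ?Z) ** X) = trace (X ** X ** (P ** ?Z))"
        by (rule trace_cyclic)
      finally show ?thesis by (simp add: matrix_mul_assoc)
    qed
    moreover have "trace (?Z ** ?C) = - 2 * trace (X ** P ** X ** ?Z)"
      using trace_mul_sym[of ?Z "X ** P ** X"]
      by (simp add: matrix_ring_simps linear_neg[OF linear_trace] linear_cmul[OF linear_trace])
    ultimately show ?thesis
      using wasserstein_metric_deriv_eq[OF P Vs Vs H] wasserstein_metric_deriv_eq[OF P H Vs Vs]
      by (simp add: LV)
  qed
  show ?thesis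
    unfolding wasserstein_christoffel_def
  proof (rule the_equality, intro conjI ballI)
    show "?C \<in> sym_matrices" by (rule C)
    show "2 * wasserstein_metric P ?C H = wasserstein_metric_deriv P V V H
        + wasserstein_metric_deriv P V V H - wasserstein_metric_deriv P H V V"
      if "H \<in> sym_matrices" for H
      using left[OF C that] right[OF that] by simp
  next
    fix D
    assume D: "D \<in> sym_matrices \<and> (\<forall>H\<in>sym_matrices. 2 * wasserstein_metric P D H =
      wasserstein_metric_deriv P V V H + wasserstein_metric_deriv P V V H
      - wasserstein_metric_deriv P H V V)"
    define E where "E = D - ?C"
    have E: "E \<in> sym_matrices"
      unfolding E_def using D C by (intro subspace_diff[OF subspace_sym_matrices]) auto
    define H where "H = E ** P + P ** E"
    have H: "H \<in> sym_matrices"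
      unfolding H_def by (intro sym_lyapunov_image pd_sym P E)
    have "lyapunov P H = E"
      by (rule lyapunov_eqI[OF P E]) (simp add: H_def)
    then have "trace (E ** D) = trace (E ** ?C)"
      using D H left[of D H] right[OF H] by simp
    moreover have "trace (E ** E) = trace (E ** D) - trace (E ** ?C)"
      by (subst (2) E_def) (simp only: matrix_mult.diff_right trace_sub)
    ultimately have "trace (E ** E) = 0" by simp
    then have "E = 0" by (rule trace_square_sym_eq_0[OF E])
    then show "D = ?C" by (simp add: E_def eq_neg_iff_add_eq_0)
  qed
qed

section \<open>Wasserstein geodesics\<close>

text \<open>
  The lifted curve \<open>M t = 1 + t H\<close> commutes with its velocity \<open>H\<close>, so \<open>X = H M\<^sup>-\<^sup>1\<close> is symmetric and solves the
  Lyapunov equation for the velocity of \<open>M P M\<close>; then \<open>2 X (M P M) X = 2 H P H\<close> is exactly the acceleration.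
\<close>

lemma wasserstein_geodesic_line:
  fixes P H :: "real^'n^'n"
  assumes P: "P \<in> pd_matrices" and H: "H \<in> sym_matrices"
    and I: "open I" "is_interval I" and M: "\<And>t. t \<in> I \<Longrightarrow> mat 1 + t *\<^sub>R H \<in> pd_matrices"
  shows "wasserstein_geodesic I (\<lambda>t. (mat 1 + t *\<^sub>R H) ** P ** (mat 1 + t *\<^sub>R H))"
proof -
  define M where "M t = mat 1 + t *\<^sub>R H" for t
  define v where "v t = H ** P ** M t + M t ** P ** H" for t
  have dM: "(M has_vector_derivative H) (at t)" for t
    unfolding M_def by (auto intro!: derivative_eq_intros)
  have d\<gamma>: "((\<lambda>t. M t ** P ** M t) has_vector_derivative v t) (at t)" for t
    unfolding v_def
    by (rule has_vector_derivative_eq_rhs, rule matrix_mult.has_vector_derivative[OF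
          matrix_mult.has_vector_derivative[OF dM has_vector_derivative_const] dM])
      (simp add: matrix_ring_simps)
  have dv: "(v has_vector_derivative 2 *\<^sub>R (H ** P ** H)) (at t)" for t
    unfolding v_def
    by (rule has_vector_derivative_eq_rhs, rule has_vector_derivative_add[OF
          matrix_mult.has_vector_derivative[OF has_vector_derivative_const dM]
          matrix_mult.has_vector_derivative[OF
            matrix_mult.has_vector_derivative[OF dM has_vector_derivative_const]
            has_vector_derivative_const]])
      (simp add: matrix_ring_simps scaleR_2)
  have pd: "M t ** P ** M t \<in> pd_matrices" if t: "t \<in> I" for t
    using pd_congruence[OF P pd_invertible[OF M[OF t]]] pd_transpose[OF M[OF t]]
    by (simp add: M_def)
  have "2 *\<^sub>R (H ** P ** H) + wasserstein_christoffel (M t ** P ** M t) (v t) (v t) = 0"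
    if t: "t \<in> I" for t
  proof -
    have Mt: "M t \<in> pd_matrices" using M[OF t] by (simp add: M_def)
    let ?K = "matrix_inv (M t)"
    note cancel = matrix_inv_cancel[OF pd_invertible[OF Mt]]
    have commute: "H ** M t = M t ** H" by (simp add: M_def matrix_ring_simps)
    \<comment> \<open>\<open>X\<close> is the logarithmic velocity \<open>M' M\<^sup>-\<^sup>1\<close>, i.e. the Lyapunov solution for \<open>v t\<close>.\<close>
    define X where "X = H ** ?K"
    have XM: "X ** M t = H" by (simp add: X_def cancel)
    have "?K ** H = ?K ** (H ** M t) ** ?K" by (simp add: matrix_mul_assoc cancel)
    also have "\<dots> = X" unfolding commute by (simp add: X_def matrix_mul_assoc cancel)
    finally have X': "X = ?K ** H" by simp
    have MX: "M t ** X = H" by (simp add: X' matrix_mul_assoc cancel)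
    have "?K \<in> sym_matrices" by (rule sym_matrix_inv[OF pd_sym[OF Mt] pd_invertible[OF Mt]])
    then have X: "X \<in> sym_matrices"
      using H X' by (simp add: sym_matrices_def X_def matrix_transpose_mul)
    have v: "v t = X ** (M t ** P ** M t) + (M t ** P ** M t) ** X"
      by (simp add: v_def matrix_mul_assoc XM)
        (simp add: MX matrix_mul_assoc[symmetric])
    have "X ** (M t ** P ** M t) ** X = H ** P ** H"
      by (simp add: matrix_mul_assoc XM) (simp add: MX matrix_mul_assoc[symmetric])
    then show ?thesis
      using wasserstein_christoffel_eq[OF pd[OF t] X v] by simp
  qed
  then show ?thesis
    unfolding wasserstein_geodesic_def M_def[symmetric]
    by (intro conjI I ballI exI[of _ v] exI[of _ "\<lambda>_. 2 *\<^sub>R (H ** P ** H)"] pd d\<gamma> dv)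
qed

lemma has_vector_derivative_sym:
  fixes \<gamma> :: "real \<Rightarrow> real^'n^'n"
  assumes "(\<gamma> has_vector_derivative v) (at t)" "open J" "t \<in> J" "\<And>s. s \<in> J \<Longrightarrow> \<gamma> s \<in> sym_matrices"
  shows "v \<in> sym_matrices"
proof -
  have "((\<lambda>s. transpose (\<gamma> s)) has_vector_derivative transpose v) (at t)"
    by (rule bounded_linear.has_vector_derivative[OF _ assms(1)])
      (rule linear_transpose[unfolded linear_conv_bounded_linear])
  then have "(\<gamma> has_vector_derivative transpose v) (at t)"
    by (rule has_vector_derivative_transform_within_open[OF _ assms(2,3)])
      (use assms(4) in \<open>simp add: sym_matrices_def\<close>)
  then have "transpose v = v" using assms(1) by (rule vector_derivative_unique_at)
  then show ?thesis by (simp add: sym_matrices_def)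
qed

lemma constant_acceleration:
  fixes \<gamma> :: "real \<Rightarrow> 'a::real_normed_vector"
  assumes "convex J" "0 \<in> J" "t \<in> J"
    and \<gamma>: "\<And>s. s \<in> J \<Longrightarrow> (\<gamma> has_vector_derivative v s) (at s)"
    and v: "\<And>s. s \<in> J \<Longrightarrow> (v has_vector_derivative a) (at s)"
  shows "\<gamma> t = \<gamma> 0 + t *\<^sub>R v 0 + (t\<^sup>2 / 2) *\<^sub>R a"
proof -
  have dv: "((\<lambda>s. v s - s *\<^sub>R a) has_vector_derivative 0) (at s within J)" if "s \<in> J" for s
    by (rule has_vector_derivative_at_within,
        rule has_vector_derivative_eq_rhs[OF has_vector_derivative_diff[OF v[OF that]]])
      (auto intro!: derivative_eq_intros)
  obtain c where c: "\<And>s. s \<in> J \<Longrightarrow> v s - s *\<^sub>R a = c"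
    by (rule has_vector_derivative_zero_constant[OF \<open>convex J\<close> dv]) (assumption, rule that)
  have v0: "v s = v 0 + s *\<^sub>R a" if "s \<in> J" for s
    using c[OF that] c[OF \<open>0 \<in> J\<close>] by (simp add: algebra_simps)
  have d\<gamma>: "((\<lambda>s. \<gamma> s - (s *\<^sub>R v 0 + (s\<^sup>2 / 2) *\<^sub>R a)) has_vector_derivative 0) (at s within J)"
    if "s \<in> J" for s
    by (rule has_vector_derivative_at_within,
        rule has_vector_derivative_eq_rhs[OF has_vector_derivative_diff[OF \<gamma>[OF that]]])
      (auto intro!: derivative_eq_intros simp: v0[OF that])
  obtain d where d: "\<And>s. s \<in> J \<Longrightarrow> \<gamma> s - (s *\<^sub>R v 0 + (s\<^sup>2 / 2) *\<^sub>R a) = d"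
    by (rule has_vector_derivative_zero_constant[OF \<open>convex J\<close> d\<gamma>]) (assumption, rule that)
  show ?thesis
    using d[OF \<open>t \<in> J\<close>] d[OF \<open>0 \<in> J\<close>] by (simp add: algebra_simps)
qed

text \<open>
  The acceleration \<open>2 X \<gamma> X\<close> has derivative zero, because \<open>X' = - X\<^sup>2\<close> and \<open>\<gamma>' = X \<gamma> + \<gamma> X\<close> cancel term by
  term. Hence \<open>\<gamma>\<close> is quadratic, with coefficients \<open>X \<gamma> + \<gamma> X\<close> and \<open>X \<gamma> X\<close> at time zero.
\<close>

lemma wasserstein_geodesic_is_line:
  fixes \<gamma> :: "real \<Rightarrow> real^'n^'n"
  assumes geo: "wasserstein_geodesic J \<gamma>" and "0 \<in> J"
  obtains H where "H \<in> sym_matrices"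
    "\<And>t. t \<in> J \<Longrightarrow> \<gamma> t = (mat 1 + t *\<^sub>R H) ** \<gamma> 0 ** (mat 1 + t *\<^sub>R H)"
proof -
  have J: "open J" "convex J" and pd: "\<And>t. t \<in> J \<Longrightarrow> \<gamma> t \<in> pd_matrices"
    using geo by (auto simp: wasserstein_geodesic_def is_interval_convex)
  obtain v a where va: "\<forall>t\<in>J. (\<gamma> has_vector_derivative v t) (at t) \<and>
      (v has_vector_derivative a t) (at t) \<and>
      a t + wasserstein_christoffel (\<gamma> t) (v t) (v t) = 0"
    using geo unfolding wasserstein_geodesic_def by (elim conjE exE)
  have d\<gamma>: "(\<gamma> has_vector_derivative v t) (at t)"
    and dv: "(v has_vector_derivative a t) (at t)"
    and geodesic: "a t + wasserstein_christoffel (\<gamma> t) (v t) (v t) = 0" if "t \<in> J" for t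
    using bspec[OF va that] by simp_all
  define X where "X t = lyapunov (\<gamma> t) (v t)" for t
  have v_sym: "v t \<in> sym_matrices" if "t \<in> J" for t
    by (rule has_vector_derivative_sym[OF d\<gamma>[OF that] J(1) that]) (rule pd_sym[OF pd])
  have X: "X t \<in> sym_matrices" "X t ** \<gamma> t + \<gamma> t ** X t = v t" if "t \<in> J" for t
    unfolding X_def
    by (rule lyapunov_sym[OF pd[OF that] v_sym[OF that]],
        rule lyapunov_eq[OF pd[OF that] v_sym[OF that]])
  have a: "a t = 2 *\<^sub>R (X t ** \<gamma> t ** X t)" if "t \<in> J" for t
    using geodesic[OF that] wasserstein_christoffel_eq[OF pd[OF that] X(1)[OF that] X(2)[OF that, symmetric]]
    by simp
  have dX: "(X has_vector_derivative - (X t ** X t)) (at t)" if t: "t \<in> J" for t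
  proof (rule has_vector_derivative_lyapunov_solution[OF d\<gamma>[OF t] dv[OF t] pd[OF t]])
    show "\<forall>\<^sub>F s in nhds t. X s ** \<gamma> s + \<gamma> s ** X s = v s"
      using X(2) J(1) t unfolding eventually_nhds by blast
    show "- (X t ** X t) ** \<gamma> t + \<gamma> t ** - (X t ** X t) = a t - (X t ** v t + v t ** X t)"
      by (simp add: a[OF t] X(2)[OF t, symmetric] matrix_ring_simps scaleR_2)
  qed
  have "(a has_vector_derivative 0) (at t)" if t: "t \<in> J" for t
  proof (rule has_vector_derivative_transform_within_open[OF _ J(1) t a[symmetric]])
    have "((\<lambda>t. X t ** \<gamma> t ** X t) has_vector_derivative
      X t ** \<gamma> t ** - (X t ** X t) + (X t ** v t + - (X t ** X t) ** \<gamma> t) ** X t) (at t)"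
      by (intro matrix_mult.has_vector_derivative dX d\<gamma> t)
    also have "X t ** \<gamma> t ** - (X t ** X t) + (X t ** v t + - (X t ** X t) ** \<gamma> t) ** X t = 0"
      by (simp add: X(2)[OF t, symmetric] matrix_ring_simps)
    finally show "((\<lambda>t. 2 *\<^sub>R (X t ** \<gamma> t ** X t)) has_vector_derivative 0) (at t)"
      by (rule has_vector_derivative_eq_rhs[OF
            bounded_linear.has_vector_derivative[OF bounded_linear_scaleR_right]]) simp
  qed simp
  then have da: "(a has_vector_derivative 0) (at t within J)" if "t \<in> J" for t
    using that has_vector_derivative_at_within by blast
  obtain c where c: "\<And>t. t \<in> J \<Longrightarrow> a t = c"
    by (rule has_vector_derivative_zero_constant[OF J(2) da]) (assumption, rule that)
  show thesis
  proof (rule that[OF X(1)[OF \<open>0 \<in> J\<close>]])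
    fix t assume t: "t \<in> J"
    have "\<gamma> t = \<gamma> 0 + t *\<^sub>R v 0 + (t\<^sup>2 / 2) *\<^sub>R c"
      by (rule constant_acceleration[OF J(2) \<open>0 \<in> J\<close> t d\<gamma>]) (use dv c in auto)
    also have "c = 2 *\<^sub>R (X 0 ** \<gamma> 0 ** X 0)"
      using a[OF \<open>0 \<in> J\<close>] c[OF \<open>0 \<in> J\<close>] by simp
    finally show "\<gamma> t = (mat 1 + t *\<^sub>R X 0) ** \<gamma> 0 ** (mat 1 + t *\<^sub>R X 0)"
      by (simp add: X(2)[OF \<open>0 \<in> J\<close>, symmetric] matrix_ring_simps power2_eq_square)
  qed
qed

lemma geodesic_through_unique:
  fixes P Q :: "real^'n^'n"
  assumes geo: "geodesic_through J P Q \<gamma>" and t: "t \<in> J"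
  shows "\<gamma> t = (mat 1 + t *\<^sub>R (riccati P Q - mat 1)) ** P ** (mat 1 + t *\<^sub>R (riccati P Q - mat 1))"
proof -
  have J: "{0..1} \<subseteq> J" and ends: "\<gamma> 0 = P" "\<gamma> 1 = Q" and "wasserstein_geodesic J \<gamma>"
    using geo by (auto simp: geodesic_through_def)
  from J have "0 \<in> J" by auto
  obtain H where H: "H \<in> sym_matrices"
    and \<gamma>: "\<And>t. t \<in> J \<Longrightarrow> \<gamma> t = (mat 1 + t *\<^sub>R H) ** P ** (mat 1 + t *\<^sub>R H)"
    by (rule wasserstein_geodesic_is_line[OF \<open>wasserstein_geodesic J \<gamma>\<close> \<open>0 \<in> J\<close>, unfolded ends])
      (rule that)
  have pd: "\<gamma> t \<in> pd_matrices" if "t \<in> J" for t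
    using \<open>wasserstein_geodesic J \<gamma>\<close> that by (simp add: wasserstein_geodesic_def)
  have "invertible (mat 1 + t *\<^sub>R H)" if "0 \<le> t" "t \<le> 1" for t
  proof -
    have "t \<in> J" using that J by auto
    from pd_invertible[OF pd[OF this]] obtain N where "N ** \<gamma> t = mat 1"
      by (auto simp: invertible_def)
    then have "(N ** (mat 1 + t *\<^sub>R H) ** P) ** (mat 1 + t *\<^sub>R H) = mat 1"
      by (simp add: \<gamma>[OF \<open>t \<in> J\<close>] matrix_mul_assoc)
    then show ?thesis using invertible_left_inverse by blast
  qed
  then have "mat 1 + H \<in> pd_matrices"
    by (rule pd_of_invertible_segment[OF H])
  moreover have "P \<in> pd_matrices" using pd[OF \<open>0 \<in> J\<close>] ends by simp
  moreover have "(mat 1 + H) ** P ** (mat 1 + H) = Q"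
    using \<gamma>[of 1] ends subsetD[OF J, of 1] by simp
  ultimately have "riccati P Q = mat 1 + H" by (intro riccati_eqI)
  then show ?thesis using \<gamma>[OF t] by simp
qed

section \<open>Geodesic surfaces\<close>

lemma affine_surface_has_derivative:
  "(affine_surface A0 A has_derivative (\<lambda>h. \<Sum>j\<in>UNIV. h $ j *\<^sub>R (A j - A0))) (at \<theta>)"
  unfolding affine_surface_def
  by (auto intro!: derivative_eq_intros bounded_linear.has_derivative[OF bounded_linear_vec_nth])

lemma sum_axis_scaleR:
  fixes f :: "'k::finite \<Rightarrow> 'a::real_vector"
  shows "(\<Sum>i\<in>UNIV. axis j (1::real) $ i *\<^sub>R f i) = f j"
proof -
  have "(\<Sum>i\<in>UNIV. axis j (1::real) $ i *\<^sub>R f i) = (\<Sum>i\<in>UNIV. if i = j then f j else 0)"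
    by (intro sum.cong) (auto simp: axis_def)
  then show ?thesis by simp
qed

lemma frechet_derivative_affine_surface:
  "frechet_derivative (affine_surface A0 A) (at \<theta>) (axis j 1) = A j - A0"
  unfolding frechet_derivative_at[OF affine_surface_has_derivative, symmetric]
  by (rule sum_axis_scaleR)

lemma affine_surface_axis: "affine_surface A0 A (t *\<^sub>R axis j 1) = A0 + t *\<^sub>R (A j - A0)"
  using sum_axis_scaleR[of j "\<lambda>i. t *\<^sub>R (A i - A0)"]
  by (simp add: affine_surface_def mult.commute)

lemma edge_in_unit_simplex:
  assumes "0 \<le> t" "t \<le> 1"
  shows "t *\<^sub>R axis j 1 \<in> (unit_simplex :: (real^'k) set)"
proof -
  have "(\<Sum>i\<in>UNIV. (t *\<^sub>R axis j 1 :: real^'k) $ i) = (\<Sum>i\<in>UNIV. if i = j then t else 0)"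
    by (intro sum.cong) (auto simp: axis_def)
  with assms show ?thesis by (auto simp: unit_simplex_def axis_def)
qed

lemma affine_surface_mult_right:
  fixes A0 :: "real^'n^'n"
  shows "affine_surface (B0 ** A0) (\<lambda>j. B j ** A0) \<theta> = affine_surface B0 B \<theta> ** A0"
  by (simp add: affine_surface_def matrix_ring_simps matrix_mult.sum_left)

text \<open>
  Horizontality at the origin says \<open>A\<^sub>j = (1 + H\<^sub>j) A\<^sub>0\<close> with \<open>H\<^sub>j\<close> symmetric, and invertibility along
  the edge from the origin to the \<open>j\<close>-th vertex forces \<open>1 + H\<^sub>j\<close> to be positive definite.
\<close>

lemma horizontal_affine_surface_vertex:
  fixes A0 :: "real^'n^'n" and A :: "'k::finite \<Rightarrow> real^'n^'n"
  assumes hor: "horizontal_surface \<Theta> (affine_surface A0 A)" and \<Theta>: "unit_simplex \<subseteq> \<Theta>"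
    and P: "A0 ** transpose A0 \<in> pd_matrices"
  shows "A j = riccati (A0 ** transpose A0) (A j ** transpose (A j)) ** A0"
proof -
  have inv: "invertible (A0 + t *\<^sub>R (A j - A0))" if "0 \<le> t" "t \<le> 1" for t
    using hor \<Theta> edge_in_unit_simplex[OF that, of j]
    unfolding horizontal_surface_def affine_surface_axis[symmetric] by blast
  have inv0: "invertible A0" using inv[of 0] by simp
  have "affine_surface A0 A 0 = A0" by (simp add: affine_surface_def)
  moreover have "0 \<in> \<Theta>" using edge_in_unit_simplex[of 0] \<Theta> by auto
  ultimately have H: "(A j - A0) ** matrix_inv A0 \<in> sym_matrices" (is "?H \<in> _")
    using bspec[OF hor[unfolded horizontal_surface_def], of 0]
    by (simp add: frechet_derivative_affine_surface)
  have eq: "A0 + t *\<^sub>R (A j - A0) = (mat 1 + t *\<^sub>R ?H) ** A0" for t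
    by (simp add: matrix_ring_simps matrix_inv_cancel[OF inv0])
  have "invertible (mat 1 + t *\<^sub>R ?H)" if "0 \<le> t" "t \<le> 1" for t
  proof -
    have "mat 1 + t *\<^sub>R ?H = (A0 + t *\<^sub>R (A j - A0)) ** matrix_inv A0"
      unfolding eq by (simp add: matrix_inv_cancel[OF inv0])
    then show ?thesis
      using invertible_mult[OF inv[OF that] invertible_matrix_inv[OF inv0]] by simp
  qed
  then have pd: "mat 1 + ?H \<in> pd_matrices" by (rule pd_of_invertible_segment[OF H])
  have A: "A j = (mat 1 + ?H) ** A0" using eq[of 1] by simp
  have "riccati (A0 ** transpose A0) (A j ** transpose (A j)) = mat 1 + ?H"
  proof (rule riccati_eqI[OF P pd])
    show "(mat 1 + ?H) ** (A0 ** transpose A0) ** (mat 1 + ?H) = A j ** transpose (A j)"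
      unfolding A[symmetric] using A pd_transpose[OF pd]
      by (metis matrix_mul_assoc matrix_transpose_mul)
  qed
  then show ?thesis using A by simp
qed

lemma sym_product_iff_commute:
  assumes "A \<in> sym_matrices" "B \<in> sym_matrices"
  shows "A ** B \<in> sym_matrices \<longleftrightarrow> A ** B = B ** A"
  using assms by (auto simp: sym_matrices_def matrix_transpose_mul)

lemma commute_matrix_inv_iff:
  fixes A M :: "real^'n^'n"
  assumes "invertible M"
  shows "A ** matrix_inv M = matrix_inv M ** A \<longleftrightarrow> A ** M = M ** A"
proof
  assume "A ** matrix_inv M = matrix_inv M ** A"
  then have "M ** (A ** matrix_inv M) ** M = M ** (matrix_inv M ** A) ** M" by simp
  then show "A ** M = M ** A"
    by (simp add: matrix_mul_assoc matrix_inv_cancel assms)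
next
  let ?K = "matrix_inv M"
  assume "A ** M = M ** A"
  then have "?K ** (A ** M) ** ?K = ?K ** (M ** A) ** ?K" by simp
  then show "A ** ?K = ?K ** A"
    by (simp add: matrix_mul_assoc matrix_inv_cancel assms)
qed

lemma affine_surface_sym:
  assumes "B0 \<in> sym_matrices" "\<And>j. B j \<in> sym_matrices"
  shows "affine_surface B0 B \<theta> \<in> sym_matrices"
  unfolding affine_surface_def using assms
  by (intro subspace_add subspace_sum subspace_scale subspace_diff subspace_sym_matrices)

text \<open>
  On the simplex the surface is the convex combination of its vertices with weight
  \<open>1 - \<Sum>\<^sub>j \<theta>\<^sub>j\<close> at the base point.
\<close>

lemma affine_surface_in_convex:
  assumes C: "convex C" and B: "B0 \<in> C" "\<And>j. B j \<in> C" and \<theta>: "\<theta> \<in> unit_simplex"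
  shows "affine_surface B0 B \<theta> \<in> C"
proof -
  define s where "s = (\<Sum>j\<in>UNIV. \<theta> $ j)"
  have \<theta>': "0 \<le> \<theta> $ j" "s \<le> 1" for j
    using \<theta> by (auto simp: unit_simplex_def s_def)
  then have "0 \<le> s" by (simp add: s_def sum_nonneg)
  have eq: "affine_surface B0 B \<theta> = (1 - s) *\<^sub>R B0 + (\<Sum>j\<in>UNIV. \<theta> $ j *\<^sub>R B j)"
    by (simp add: affine_surface_def s_def scaleR_diff_right sum_subtractf scaleR_sum_left
        scaleR_diff_left)
  show ?thesis
  proof (cases "s = 0")
    case True
    then have "\<theta> $ j = 0" for j
      using \<theta>'(1) by (simp add: s_def sum_nonneg_eq_0_iff)
    then show ?thesis using B by (simp add: affine_surface_def)
  next
    case False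
    have "(\<Sum>j\<in>UNIV. (\<theta> $ j / s) *\<^sub>R B j) \<in> C"
      using False \<theta>' B \<open>0 \<le> s\<close>
      by (intro convex_sum[OF _ C]) (simp_all add: sum_divide_distrib[symmetric] s_def[symmetric])
    then have "(1 - s) *\<^sub>R B0 + s *\<^sub>R (\<Sum>j\<in>UNIV. (\<theta> $ j / s) *\<^sub>R B j) \<in> C"
      using \<theta>' \<open>0 \<le> s\<close> B by (intro convexD[OF C]) auto
    then show ?thesis using False by (simp add: eq scaleR_sum_right)
  qed
qed

text \<open>
  The affine lift is the right translate by \<open>A\<^sub>0\<close> of the surface based at the identity with vertices \<open>T\<^sub>j\<close>,
  so only \<open>A\<^sub>0 A\<^sub>0\<^sup>T = P\<close> is left of the choice of \<open>A\<^sub>0\<close>. Horizontality at the vertices of the simplex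
  then yields commutation.
\<close>

lemma geodesic_surface_through_unique:
  fixes P :: "real^'n^'n" and S :: "'k::finite \<Rightarrow> real^'n^'n"
  assumes geo: "geodesic_surface_through \<Theta> P S \<Gamma>" and P: "P \<in> pd_matrices"
    and S: "\<And>j. S j \<in> pd_matrices"
  defines "T \<equiv> \<lambda>j. riccati P (S j)"
  shows "\<theta> \<in> \<Theta> \<Longrightarrow> \<Gamma> \<theta> = affine_surface (mat 1) T \<theta> ** P ** affine_surface (mat 1) T \<theta>"
    and "T i ** T j = T j ** T i"
proof -
  obtain A0 A where hor: "horizontal_surface \<Theta> (affine_surface A0 A)"
    and A0: "A0 ** transpose A0 = P" and A: "\<And>j. A j ** transpose (A j) = S j"
    and \<Gamma>: "\<And>\<theta>. \<theta> \<in> \<Theta> \<Longrightarrow> \<Gamma> \<theta> = affine_surface A0 A \<theta> ** transpose (affine_surface A0 A \<theta>)"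
    and \<Theta>: "unit_simplex \<subseteq> \<Theta>"
    using geo unfolding geodesic_surface_through_def by blast
  have T: "T j \<in> pd_matrices" for j
    unfolding T_def by (rule riccati[OF P S])
  have AT: "A j = T j ** A0" for j
    using horizontal_affine_surface_vertex[OF hor \<Theta>] P by (simp add: A0 A T_def)
  then have "A = (\<lambda>j. T j ** A0)" by auto
  then have lift: "affine_surface A0 A \<theta> = affine_surface (mat 1) T \<theta> ** A0" for \<theta>
    using affine_surface_mult_right[of "mat 1" A0 T \<theta>] by simp
  have "affine_surface (mat 1) T \<theta> \<in> sym_matrices" for \<theta>
    using T pd_sym by (intro affine_surface_sym) auto
  then show "\<Gamma> \<theta> = affine_surface (mat 1) T \<theta> ** P ** affine_surface (mat 1) T \<theta>" if "\<theta> \<in> \<Theta>"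
    using \<Gamma>[OF that]
    by (simp add: lift matrix_transpose_mul sym_matrices_def A0[symmetric] matrix_mul_assoc)
  have vertex: "axis i 1 \<in> \<Theta>" "affine_surface A0 A (axis i 1) = A i" for i
    using edge_in_unit_simplex[of 1 i] \<Theta> affine_surface_axis[of A0 A 1 i] by auto
  have inv_T: "invertible (T i)" by (rule pd_invertible[OF T])
  have "invertible P" by (rule pd_invertible[OF P])
  then have inv_A0: "invertible A0"
    unfolding A0[symmetric] using invertible_right_inverse[of A0]
      invertible_right_inverse[of "A0 ** transpose A0"] by (metis matrix_mul_assoc)
  have "(A j - A0) ** matrix_inv (A i) \<in> sym_matrices"
    using bspec[OF hor[unfolded horizontal_surface_def] vertex(1)[of i]]
    by (simp add: frechet_derivative_affine_surface vertex(2))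
  also have "(A j - A0) ** matrix_inv (A i) = (T j - mat 1) ** matrix_inv (T i)"
    unfolding AT matrix_inv_mult[OF inv_T inv_A0]
    by (simp add: matrix_ring_simps matrix_inv_cancel[OF inv_A0])
  finally have "(T j - mat 1) ** matrix_inv (T i) = matrix_inv (T i) ** (T j - mat 1)"
    by (subst (asm) sym_product_iff_commute)
      (auto intro!: subspace_diff[OF subspace_sym_matrices] pd_sym[OF T] sym_matrix_inv inv_T)
  then show "T i ** T j = T j ** T i"
    by (simp add: commute_matrix_inv_iff[OF inv_T] matrix_ring_simps)
qed

text \<open>
  The lift \<open>\<theta> \<mapsto> (M \<theta>) R\<close> with \<open>R\<^sup>2 = P\<close> has logarithmic derivatives \<open>(T\<^sub>j - 1) (M \<theta>)\<^sup>-\<^sup>1\<close>, which are products of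
  commuting symmetric matrices.
\<close>

lemma commuting_geodesic_surface:
  fixes P :: "real^'n^'n" and T :: "'k::finite \<Rightarrow> real^'n^'n"
  assumes P: "P \<in> pd_matrices" and T: "\<And>j. T j \<in> pd_matrices"
    and commute: "\<And>i j. T i ** T j = T j ** T i"
  defines "M \<equiv> affine_surface (mat 1) T"
  shows "geodesic_surface_through {\<theta>. M \<theta> \<in> pd_matrices} P (\<lambda>j. T j ** P ** T j)
    (\<lambda>\<theta>. M \<theta> ** P ** M \<theta>)"
proof -
  obtain R where R: "R \<in> pd_matrices" "R ** R = P"
    by (rule pd_square_root_exists[OF P])
  let ?A = "\<lambda>j. T j ** R"
  have lift: "affine_surface R ?A \<theta> = M \<theta> ** R" for \<theta>
    using affine_surface_mult_right[of "mat 1" R T \<theta>] by (simp add: M_def)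
  have M_sym: "M \<theta> \<in> sym_matrices" for \<theta>
    unfolding M_def using T pd_sym by (intro affine_surface_sym) auto
  have "continuous (at \<theta>) M" for \<theta>
    unfolding M_def by (rule has_derivative_continuous[OF affine_surface_has_derivative])
  then have op: "open {\<theta>. M \<theta> \<in> pd_matrices}"
    using M_sym by (intro open_pd_preimage continuous_at_imp_continuous_on) auto
  have simplex: "unit_simplex \<subseteq> {\<theta>. M \<theta> \<in> pd_matrices}"
    unfolding M_def
    by (intro subsetI CollectI affine_surface_in_convex[OF convex_pd_matrices pd_mat_1] T)
  have commute_M: "(T j - mat 1) ** M \<theta> = M \<theta> ** (T j - mat 1)" for j \<theta>
    by (simp add: M_def affine_surface_def matrix_ring_simps matrix_mult.sum_left
        matrix_mult.sum_right sum_subtractf commute[of j])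
  have "horizontal_surface {\<theta>. M \<theta> \<in> pd_matrices} (affine_surface R ?A)"
    unfolding horizontal_surface_def
  proof (intro ballI conjI allI)
    fix \<theta> j assume "\<theta> \<in> {\<theta>. M \<theta> \<in> pd_matrices}"
    then have inv: "invertible (M \<theta>)" by (simp add: pd_invertible)
    then show "invertible (affine_surface R ?A \<theta>)"
      unfolding lift by (intro invertible_mult pd_invertible[OF R(1)])
    show "affine_surface R ?A differentiable (at \<theta>)"
      using affine_surface_has_derivative differentiable_def by blast
    have "frechet_derivative (affine_surface R ?A) (at \<theta>) (axis j 1) ** matrix_inv (affine_surface R ?A \<theta>)
        = (T j - mat 1) ** matrix_inv (M \<theta>)"
      unfolding frechet_derivative_affine_surface lift matrix_inv_mult[OF inv pd_invertible[OF R(1)]]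
      by (simp add: matrix_ring_simps matrix_inv_cancel[OF pd_invertible[OF R(1)]])
    also have "\<dots> \<in> sym_matrices"
      using commute_M[of j \<theta>]
      by (subst sym_product_iff_commute)
        (auto simp: commute_matrix_inv_iff[OF inv] intro!: subspace_diff[OF subspace_sym_matrices]
          sym_matrix_inv[OF M_sym inv] pd_sym[OF T])
    finally show "frechet_derivative (affine_surface R ?A) (at \<theta>) (axis j 1)
        ** matrix_inv (affine_surface R ?A \<theta>) \<in> sym_matrices" .
  qed
  moreover have root: "R ** transpose R = P" using R pd_transpose[OF R(1)] by simp
  have square: "(N ** R) ** transpose (N ** R) = N ** P ** N" if "N \<in> sym_matrices" for N
    using that pd_transpose[OF R(1)]
    by (simp add: matrix_transpose_mul sym_matrices_def R(2)[symmetric] matrix_mul_assoc)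
  have "?A j ** transpose (?A j) = T j ** P ** T j" for j
    by (rule square[OF pd_sym[OF T]])
  moreover have "M \<theta> ** P ** M \<theta> = affine_surface R ?A \<theta> ** transpose (affine_surface R ?A \<theta>)" for \<theta>
    unfolding lift by (rule square[OF M_sym, symmetric])
  ultimately show ?thesis
    unfolding geodesic_surface_through_def
    by (intro conjI op simplex root exI[of _ R] exI[of _ ?A] allI ballI)
qed

lemma the_geodesic_surface_throughI:
  fixes P :: "real^'n^'n" and S :: "'k::finite \<Rightarrow> real^'n^'n"
  assumes "P \<in> pd_matrices" "\<And>j. S j \<in> pd_matrices"
  defines "M \<equiv> affine_surface (mat 1) (\<lambda>j. riccati P (S j))"
  assumes "geodesic_surface_through \<Theta> P S (\<lambda>\<theta>. M \<theta> ** P ** M \<theta>)"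
  shows "the_geodesic_surface_through \<Theta> P S (\<lambda>\<theta>. M \<theta> ** P ** M \<theta>)"
  unfolding the_geodesic_surface_through_def
proof (intro conjI assms(4) allI impI ballI)
  fix \<Theta>' \<Gamma>' \<theta>
  assume "geodesic_surface_through \<Theta>' P S \<Gamma>'" "\<theta> \<in> \<Theta> \<inter> \<Theta>'"
  then show "\<Gamma>' \<theta> = M \<theta> ** P ** M \<theta>"
    using geodesic_surface_through_unique(1)[of \<Theta>' P S \<Gamma>' \<theta>] assms(1,2) unfolding M_def by blast
qed

theorem corollary9:
  shows
   "(\<forall>(S\<^sub>0 :: real^'n^'n) \<in> pd_matrices. \<forall>S\<^sub>1 \<in> pd_matrices.
       let T = riccati S\<^sub>0 S\<^sub>1;
           \<gamma> = (\<lambda>\<theta>. ((1 - \<theta>) *\<^sub>R mat 1 + \<theta> *\<^sub>R T) ** S\<^sub>0 ** ((1 - \<theta>) *\<^sub>R mat 1 + \<theta> *\<^sub>R T))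
       in \<exists>I. open I \<and> is_interval I \<and> {0..1} \<subseteq> I \<and>
            the_geodesic_through I S\<^sub>0 S\<^sub>1 \<gamma> \<and>
            the_geodesic_surface_through {\<theta> :: real^1. \<theta> $ 1 \<in> I} S\<^sub>0 (\<lambda>_. S\<^sub>1) (\<lambda>\<theta>. \<gamma> (\<theta> $ 1)))
    \<and>
    (\<forall>(S\<^sub>0 :: real^'n^'n) \<in> pd_matrices. \<forall>S :: 'k::finite \<Rightarrow> real^'n^'n. (\<forall>j. S j \<in> pd_matrices) \<longrightarrow>
       (let T = (\<lambda>j. riccati S\<^sub>0 (S j));
            M = (\<lambda>\<theta> :: real^'k. mat 1 + (\<Sum>j\<in>UNIV. \<theta> $ j *\<^sub>R (T j - mat 1)))
        in (\<exists>\<Theta>. open \<Theta> \<and> unit_simplex \<subseteq> \<Theta> \<and>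
              the_geodesic_surface_through \<Theta> S\<^sub>0 S (\<lambda>\<theta>. M \<theta> ** S\<^sub>0 ** M \<theta>))
           \<longleftrightarrow> (\<forall>i j. T i ** T j = T j ** T i)))"
proof (intro conjI ballI allI impI)
  fix S\<^sub>0 S\<^sub>1 :: "real^'n^'n"
  assume P: "S\<^sub>0 \<in> pd_matrices" and Q: "S\<^sub>1 \<in> pd_matrices"
  define T where "T = riccati S\<^sub>0 S\<^sub>1"
  define H where "H = T - mat 1"
  have T: "T \<in> pd_matrices" "T ** S\<^sub>0 ** T = S\<^sub>1"
    unfolding T_def by (rule riccati[OF P Q])+
  have H: "H \<in> sym_matrices"
    unfolding H_def by (intro subspace_diff[OF subspace_sym_matrices] pd_sym[OF T(1)]) simp
  have segment: "(1 - t) *\<^sub>R mat 1 + t *\<^sub>R T = mat 1 + t *\<^sub>R H" for t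
    by (simp add: H_def algebra_simps)
  define I where "I = {t. mat 1 + t *\<^sub>R H \<in> pd_matrices}"
  have I_open: "open I"
    unfolding I_def
    by (rule open_pd_preimage; intro continuous_intros subspace_add[OF subspace_sym_matrices]
        subspace_scale[OF subspace_sym_matrices] H mat_1_in_sym_matrices)
  have "convex I"
  proof (rule convexI)
    fix a b u v :: real
    assume ab: "a \<in> I" "b \<in> I" and uv: "0 \<le> u" "0 \<le> v" "u + v = 1"
    have "mat 1 + (u *\<^sub>R a + v *\<^sub>R b) *\<^sub>R H = (u + v) *\<^sub>R mat 1 + (u *\<^sub>R a + v *\<^sub>R b) *\<^sub>R H"
      using uv by simp
    also have "\<dots> = u *\<^sub>R (mat 1 + a *\<^sub>R H) + v *\<^sub>R (mat 1 + b *\<^sub>R H)"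
      by (simp add: algebra_simps)
    also have "\<dots> \<in> pd_matrices"
      using ab uv by (intro convexD[OF convex_pd_matrices]) (auto simp: I_def)
    finally show "u *\<^sub>R a + v *\<^sub>R b \<in> I" by (simp add: I_def)
  qed
  then have I_int: "is_interval I" by (simp add: is_interval_convex_1)
  have ends: "0 \<in> I" "1 \<in> I" using T(1) pd_mat_1 by (auto simp: I_def H_def)
  then have I01: "{0..1} \<subseteq> I"
    using mem_is_interval_1_I[OF I_int ends] by auto
  have "geodesic_through I S\<^sub>0 S\<^sub>1 (\<lambda>t. (mat 1 + t *\<^sub>R H) ** S\<^sub>0 ** (mat 1 + t *\<^sub>R H))"
    unfolding geodesic_through_def
    using wasserstein_geodesic_line[OF P H I_open I_int] I01 T(2)
    by (simp add: I_def H_def)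
  then have curve: "the_geodesic_through I S\<^sub>0 S\<^sub>1 (\<lambda>t. (mat 1 + t *\<^sub>R H) ** S\<^sub>0 ** (mat 1 + t *\<^sub>R H))"
    unfolding the_geodesic_through_def
  proof (intro conjI allI impI ballI)
    fix J \<delta> t assume "geodesic_through J S\<^sub>0 S\<^sub>1 \<delta>" "t \<in> I \<inter> J"
    then show "\<delta> t = (mat 1 + t *\<^sub>R H) ** S\<^sub>0 ** (mat 1 + t *\<^sub>R H)"
      using geodesic_through_unique[of J S\<^sub>0 S\<^sub>1 \<delta> t] unfolding H_def T_def by blast
  qed
  have M: "affine_surface (mat 1) (\<lambda>_. T) \<theta> = mat 1 + \<theta> $ 1 *\<^sub>R H" for \<theta> :: "real^1"
    by (simp add: affine_surface_def H_def UNIV_1)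
  have surface: "the_geodesic_surface_through {\<theta> :: real^1. \<theta> $ 1 \<in> I} S\<^sub>0 (\<lambda>_. S\<^sub>1)
      (\<lambda>\<theta>. (mat 1 + \<theta> $ 1 *\<^sub>R H) ** S\<^sub>0 ** (mat 1 + \<theta> $ 1 *\<^sub>R H))"
    using the_geodesic_surface_throughI[OF P, of "\<lambda>_::1. S\<^sub>1" "{\<theta>. \<theta> $ 1 \<in> I}"]
      commuting_geodesic_surface[OF P, of "\<lambda>_::1. T"] T Q
    by (simp add: M T_def[symmetric] I_def)
  show "let T = riccati S\<^sub>0 S\<^sub>1;
      \<gamma> = (\<lambda>\<theta>. ((1 - \<theta>) *\<^sub>R mat 1 + \<theta> *\<^sub>R T) ** S\<^sub>0 ** ((1 - \<theta>) *\<^sub>R mat 1 + \<theta> *\<^sub>R T))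
    in \<exists>I. open I \<and> is_interval I \<and> {0..1} \<subseteq> I \<and>
      the_geodesic_through I S\<^sub>0 S\<^sub>1 \<gamma> \<and>
      the_geodesic_surface_through {\<theta> :: real^1. \<theta> $ 1 \<in> I} S\<^sub>0 (\<lambda>_. S\<^sub>1) (\<lambda>\<theta>. \<gamma> (\<theta> $ 1))"
    unfolding Let_def T_def[symmetric] segment
    using I_open I_int I01 curve surface by (intro exI[of _ I] conjI)
next
  fix S\<^sub>0 :: "real^'n^'n" and S :: "'k \<Rightarrow> real^'n^'n"
  assume P: "S\<^sub>0 \<in> pd_matrices" and "\<forall>j. S j \<in> pd_matrices"
  then have S: "S j \<in> pd_matrices" for j by blast
  define T where "T = (\<lambda>j. riccati S\<^sub>0 (S j))"
  have T: "T j \<in> pd_matrices" "T j ** S\<^sub>0 ** T j = S j" for j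
    unfolding T_def by (rule riccati[OF P S])+
  have "(\<exists>\<Theta>. open \<Theta> \<and> unit_simplex \<subseteq> \<Theta> \<and> the_geodesic_surface_through \<Theta> S\<^sub>0 S
      (\<lambda>\<theta>. affine_surface (mat 1) T \<theta> ** S\<^sub>0 ** affine_surface (mat 1) T \<theta>))
    \<longleftrightarrow> (\<forall>i j. T i ** T j = T j ** T i)" (is "?surface \<longleftrightarrow> ?commute")
  proof
    assume ?surface
    then obtain \<Theta> where "geodesic_surface_through \<Theta> S\<^sub>0 S
      (\<lambda>\<theta>. affine_surface (mat 1) T \<theta> ** S\<^sub>0 ** affine_surface (mat 1) T \<theta>)"
      unfolding the_geodesic_surface_through_def by blast
    from geodesic_surface_through_unique(2)[OF this P S]
    show ?commute unfolding T_def by (intro allI)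
  next
    assume ?commute
    then have geo: "geodesic_surface_through {\<theta>. affine_surface (mat 1) T \<theta> \<in> pd_matrices} S\<^sub>0 S
      (\<lambda>\<theta>. affine_surface (mat 1) T \<theta> ** S\<^sub>0 ** affine_surface (mat 1) T \<theta>)"
      using commuting_geodesic_surface[OF P, of T] T by simp
    then have "the_geodesic_surface_through {\<theta>. affine_surface (mat 1) T \<theta> \<in> pd_matrices} S\<^sub>0 S
      (\<lambda>\<theta>. affine_surface (mat 1) T \<theta> ** S\<^sub>0 ** affine_surface (mat 1) T \<theta>)"
      unfolding T_def by (rule the_geodesic_surface_throughI[OF P S])
    with geo show ?surface
      unfolding geodesic_surface_through_def[of "{\<theta>. affine_surface (mat 1) T \<theta> \<in> pd_matrices}"]
      by blast
  qed
  then show "let T = (\<lambda>j. riccati S\<^sub>0 (S j));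
      M = (\<lambda>\<theta> :: real^'k. mat 1 + (\<Sum>j\<in>UNIV. \<theta> $ j *\<^sub>R (T j - mat 1)))
    in (\<exists>\<Theta>. open \<Theta> \<and> unit_simplex \<subseteq> \<Theta> \<and>
        the_geodesic_surface_through \<Theta> S\<^sub>0 S (\<lambda>\<theta>. M \<theta> ** S\<^sub>0 ** M \<theta>))
      \<longleftrightarrow> (\<forall>i j. T i ** T j = T j ** T i)"
    unfolding Let_def T_def affine_surface_def .
qed

end
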